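(* Let $0<c_1\le1$ and $c_2\ge1$, and let $C^*(c_1,c_2)$ be the constant described in the context. There is a constant $C(c_1)$ depending only on $c_1$ such that the following holds for every $n\ge2$ and $\sigma>0$. Suppose $\theta^*\in\mathbb{R}^n$ has $k\ge1$ jumps with signs $s_1,\dots,s_k$, with constant pieces of lengths $n_0,\dots,n_k$, put $s_0=s_{k+1}=0$, and assume $$\min_{0\le i\le k:\,s_i\ne s_{i+1}}n_i\ge\frac{c_1n}{k+1}\quad\text{and}\quad\max_{0\le i\le k:\,s_i\ne s_{i+1}}n_i\le\frac{c_2n}{k+1}.$$ Let $Y\sim N_n(\theta^*,\sigma^2I_n)$. Then for every $\Gamma\ge C^*(c_1,c_2)$: If $\lambda=\Gamma\sqrt{\frac{n}{\sum_{i=0}^kI\{s_i\ne s_{i+1}\}}\left(\log\frac{en}{k+1}\right)}$, then $$R(\hat\theta^{(1)}_\lambda,\theta^* )\le C(c_1)\sigma^2(1+\Gamma^2)\frac{k+1}{n}\log\frac{en}{k+1}.$$ If $\lambda=\Gamma\sqrt{n\log(en)}$, then $$R(\hat\theta^{(1)}_\lambda,\theta^* )\le C(c_1)\frac{\sigma^2(k+1)(\log(en))}{n}\left(1+\Gamma^2\sum_{i=0}^kI\{s_i\ne s_{i+1}\}\right).$$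
   Context: For $\theta\in\mathbb{R}^n$, $D\theta := (\theta_2-\theta_1,\dots,\theta_n-\theta_{n-1})$. $\|\cdot\|$ is the Euclidean norm, $\|\cdot\|_1$ the $\ell^1$ norm. Penalized estimator of order $r=1$: $\hat\theta^{(1)}_\lambda := \operatorname{argmin}_{\theta\in\mathbb{R}^n}\big(\frac12\|Y-\theta\|^2+\sigma\lambda\|D\theta\|_1\big)$. Risk: $R(\hat\theta,\theta^* ) := \frac1n\mathbb{E}_{\theta^*}\|\hat\theta-\theta^*\|^2$. Jumps: an index $2\le j\le n$ is a jump of $\theta$ if $\theta_{j-1}\ne\theta_j$; its sign is $+1$ if $\theta_{j-1}<\theta_j$ and $-1$ otherwise. If $2\le j_1<\dots<j_k\le n$ are the jumps of $\theta^*$, then $n_0=j_1-1$, $n_i=j_{i+1}-j_i$ ($1\le i\le k-1$), $n_k=n+1-j_k$. With $f(\theta) := \|D\theta\|_1$, subdifferential $\partial f(\theta^* )$ and $\operatorname{aff}$ denoting the affine hull, let $v_0 := \operatorname{argmin}_{v\in\operatorname{aff}(\partial f(\theta^* ))}\|v\|$ (non-zero), $\lambda_{\theta^*}(z) := \operatorname{argmin}_{\lambda\ge0}\inf_{v\in\partial f(\theta^* )}\|z-\lambda v\|$, and $\lambda^* := \mathbb{E}\lambda_{\theta^*}(Z)+\frac2{\|v_0\|}$ where $Z\sim N_n(0,I_n)$. $C^*(c_1,c_2)$ denotes a positive constant depending only on $c_1,c_2$ such that, for every $n\ge2$ and every $\theta^*\in\mathbb{R}^n$ with $k\ge1$ jumps,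 with signs $s_1,\dots,s_k$ (and $s_0=s_{k+1}=0$) and constant pieces of lengths $n_0,\dots,n_k$, satisfying $\min_{0\le i\le k:\,s_i\ne s_{i+1}}n_i\ge\frac{c_1n}{k+1}$ and $\max_{0\le i\le k:\,s_i\ne s_{i+1}}n_i\le\frac{c_2n}{k+1}$, one has $\lambda^*\le C^*(c_1,c_2)\sqrt{\frac{n}{\sum_{i=0}^kI\{s_i\ne s_{i+1}\}}\log\frac{en}{k+1}}$. (The paper shows such a constant exists.) The paper assumes $n\ge2r$ throughout (here $r=1$). *)

theory Defs
  imports "HOL-Probability.Probability"
begin

section \<open>Euclidean space with a variable dimension\<close>

text \<open>The constants in the theorem are uniform in \<open>n\<close>, so the dimension cannot be a type. A vector of
  \<open>\<real>\<^sup>n\<close> is a function on the indices \<open>1, \<dots>, n\<close>, extensional as in the product measure \<^const>\<open>PiM\<close>.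
  Norms and inner products only look at these indices.\<close>

definition Rn :: "nat \<Rightarrow> (nat \<Rightarrow> real) set" where
  "Rn n = {1..n} \<rightarrow>\<^sub>E UNIV"

definition norm2 :: "nat \<Rightarrow> (nat \<Rightarrow> real) \<Rightarrow> real" where
  "norm2 n x = L2_set x {1..n}"

definition norm1 :: "nat \<Rightarrow> (nat \<Rightarrow> real) \<Rightarrow> real" where
  "norm1 n x = (\<Sum>i=1..n. \<bar>x i\<bar>)"

definition inner_n :: "nat \<Rightarrow> (nat \<Rightarrow> real) \<Rightarrow> (nat \<Rightarrow> real) \<Rightarrow> real" where
  "inner_n n x y = (\<Sum>i=1..n. x i * y i)"

text \<open>\<^const>\<open>hull\<close> with \<^const>\<open>affine\<close> is not available on functions, which are not of class
  \<^class>\<open>real_vector\<close>; this is the set of affine combinations, as in \<open>affine_hull_explicit\<close>.\<close>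

definition affine_hull_n :: "nat \<Rightarrow> (nat \<Rightarrow> real) set \<Rightarrow> (nat \<Rightarrow> real) set" where
  "affine_hull_n n S =
     {x. \<exists>F u. finite F \<and> F \<noteq> {} \<and> F \<subseteq> S \<and> sum u F = 1 \<and>
               x = (\<lambda>i\<in>{1..n}. \<Sum>v\<in>F. u v * v i)}"

definition subdifferential ::
  "nat \<Rightarrow> ((nat \<Rightarrow> real) \<Rightarrow> real) \<Rightarrow> (nat \<Rightarrow> real) \<Rightarrow> (nat \<Rightarrow> real) set" where
  "subdifferential n f x = {v \<in> Rn n. \<forall>y\<in>Rn n. f y \<ge> f x + inner_n n v (y - x)}"

text \<open>\<open>N\<^sub>n(\<mu>, \<sigma>\<^sup>2 I\<^sub>n)\<close>; note that \<^const>\<open>normal_density\<close> takes the standard deviation.\<close>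

definition gaussian :: "nat \<Rightarrow> (nat \<Rightarrow> real) \<Rightarrow> real \<Rightarrow> (nat \<Rightarrow> real) measure" where
  "gaussian n \<mu> \<sigma> =
     PiM {1..n} (\<lambda>i. density lborel (\<lambda>x. ennreal (normal_density (\<mu> i) \<sigma> x)))"

section \<open>Total variation denoising\<close>

definition D :: "nat \<Rightarrow> (nat \<Rightarrow> real) \<Rightarrow> (nat \<Rightarrow> real)" where
  "D n \<theta> = (\<lambda>i\<in>{1..n-1}. \<theta> (i + 1) - \<theta> i)"

definition tv :: "nat \<Rightarrow> (nat \<Rightarrow> real) \<Rightarrow> real" where
  "tv n \<theta> = norm1 (n - 1) (D n \<theta>)"

text \<open>\<^const>\<open>arg_min_on\<close> picks some minimizer. In each use below the minimizer exists and is unique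
  (for \<open>v0\<close> and \<open>tuning\<close>: whenever \<open>\<theta>\<close> has a jump).\<close>

definition penalized_estimator ::
  "nat \<Rightarrow> real \<Rightarrow> real \<Rightarrow> (nat \<Rightarrow> real) \<Rightarrow> (nat \<Rightarrow> real)" where
  "penalized_estimator n \<sigma> l Y =
     arg_min_on (\<lambda>\<theta>. 1/2 * (norm2 n (Y - \<theta>))\<^sup>2 + \<sigma> * l * tv n \<theta>) (Rn n)"

definition squared_error ::
  "nat \<Rightarrow> ((nat \<Rightarrow> real) \<Rightarrow> (nat \<Rightarrow> real)) \<Rightarrow> (nat \<Rightarrow> real) \<Rightarrow> (nat \<Rightarrow> real) \<Rightarrow> real" where
  "squared_error n est \<theta> Y = (norm2 n (est Y - \<theta>))\<^sup>2"

text \<open>The Bochner integral is \<open>0\<close> for non-integrable functions, so a bound on \<open>risk\<close> is meaningful only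
  together with integrability of \<open>squared_error\<close>.\<close>

definition risk ::
  "nat \<Rightarrow> real \<Rightarrow> ((nat \<Rightarrow> real) \<Rightarrow> (nat \<Rightarrow> real)) \<Rightarrow> (nat \<Rightarrow> real) \<Rightarrow> real" where
  "risk n \<sigma> est \<theta> = 1 / real n * (\<integral>Y. squared_error n est \<theta> Y \<partial>gaussian n \<theta> \<sigma>)"

section \<open>Jumps, signs and constant pieces\<close>

definition jumps :: "nat \<Rightarrow> (nat \<Rightarrow> real) \<Rightarrow> nat set" where
  "jumps n \<theta> = {j \<in> {2..n}. \<theta> (j - 1) \<noteq> \<theta> j}"

definition num_jumps :: "nat \<Rightarrow> (nat \<Rightarrow> real) \<Rightarrow> nat" where
  "num_jumps n \<theta> = card (jumps n \<theta>)"

text \<open>The jumps \<open>j\<^sub>1 < \<dots> < j\<^sub>k\<close>, completed by \<open>j\<^sub>0 = 1\<close> and \<open>j\<^sub>k\<^sub>+\<^sub>1 = n + 1\<close>, so that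
  \<open>n\<^sub>i = j\<^sub>i\<^sub>+\<^sub>1 - j\<^sub>i\<close> holds for all \<open>0 \<le> i \<le> k\<close>.\<close>

definition jump_index :: "nat \<Rightarrow> (nat \<Rightarrow> real) \<Rightarrow> nat \<Rightarrow> nat" where
  "jump_index n \<theta> i =
     (if i = 0 then 1
      else if i \<le> num_jumps n \<theta> then sorted_list_of_set (jumps n \<theta>) ! (i - 1)
      else n + 1)"

definition piece_length :: "nat \<Rightarrow> (nat \<Rightarrow> real) \<Rightarrow> nat \<Rightarrow> nat" where
  "piece_length n \<theta> i = jump_index n \<theta> (i + 1) - jump_index n \<theta> i"

definition jump_sign :: "nat \<Rightarrow> (nat \<Rightarrow> real) \<Rightarrow> nat \<Rightarrow> int" where
  "jump_sign n \<theta> i =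
     (if i = 0 \<or> i > num_jumps n \<theta> then 0
      else if \<theta> (jump_index n \<theta> i - 1) < \<theta> (jump_index n \<theta> i) then 1 else -1)"

definition sign_changes :: "nat \<Rightarrow> (nat \<Rightarrow> real) \<Rightarrow> nat set" where
  "sign_changes n \<theta> = {i \<in> {0..num_jumps n \<theta>}. jump_sign n \<theta> i \<noteq> jump_sign n \<theta> (i + 1)}"

text \<open>If \<open>\<theta>\<close> has a jump, then \<open>0 \<in> sign_changes n \<theta>\<close>, so the minimum and maximum are over a nonempty set.\<close>

definition balanced :: "real \<Rightarrow> real \<Rightarrow> nat \<Rightarrow> (nat \<Rightarrow> real) \<Rightarrow> bool" where
  "balanced c1 c2 n \<theta> \<longleftrightarrow>
     real (Min (piece_length n \<theta> ` sign_changes n \<theta>)) \<ge> c1 * real n / (real (num_jumps n \<theta>) + 1) \<and>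
     real (Max (piece_length n \<theta> ` sign_changes n \<theta>)) \<le> c2 * real n / (real (num_jumps n \<theta>) + 1)"

definition log_term :: "nat \<Rightarrow> (nat \<Rightarrow> real) \<Rightarrow> real" where
  "log_term n \<theta> = ln (exp 1 * real n / (real (num_jumps n \<theta>) + 1))"

section \<open>The tuning parameter and its upper bound\<close>

definition v0 :: "nat \<Rightarrow> (nat \<Rightarrow> real) \<Rightarrow> (nat \<Rightarrow> real)" where
  "v0 n \<theta> = arg_min_on (norm2 n) (affine_hull_n n (subdifferential n (tv n) \<theta>))"

definition tuning :: "nat \<Rightarrow> (nat \<Rightarrow> real) \<Rightarrow> (nat \<Rightarrow> real) \<Rightarrow> real" where
  "tuning n \<theta> z =
     arg_min_on (\<lambda>l. INF v\<in>subdifferential n (tv n) \<theta>. norm2 n (z - (\<lambda>i. l * v i))) {0..}"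

text \<open>If \<open>\<theta>\<close> has a jump, then \<open>tuning n \<theta>\<close> is continuous and \<open>0 \<le> tuning n \<theta> z \<le> norm2 n z / norm2 n (v0 n \<theta>)\<close>,
  hence the expectation below exists.\<close>

definition lambda_star :: "nat \<Rightarrow> (nat \<Rightarrow> real) \<Rightarrow> real" where
  "lambda_star n \<theta> =
     (\<integral>z. tuning n \<theta> z \<partial>gaussian n (\<lambda>_. 0) 1) + 2 / norm2 n (v0 n \<theta>)"

definition is_Cstar :: "real \<Rightarrow> real \<Rightarrow> real \<Rightarrow> bool" where
  "is_Cstar c1 c2 Cs \<longleftrightarrow>
     Cs > 0 \<and>
     (\<forall>n\<ge>2. \<forall>\<theta>\<in>Rn n. num_jumps n \<theta> \<ge> 1 \<and> balanced c1 c2 n \<theta> \<longrightarrow>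
        lambda_star n \<theta> \<le> Cs * sqrt (real n / real (card (sign_changes n \<theta>)) * log_term n \<theta>))"

end

theory Submission
  imports Defs
begin

text \<open>
  The squared error of the estimator is at most \<open>\<sigma>\<^sup>2\<close> times the squared distance between the standardised
  noise \<open>Z\<close> and \<open>l\<close> times any subgradient of the total variation at \<open>\<theta>\<close> (\<open>squared_error_le_dual\<close>). A subgradient
  is given by a dual path on the edges: it takes the values \<open>s\<^sub>i\<close> at the jumps, vanishes at both ends of
  \<open>{1..n}\<close>, and is bounded by \<open>1\<close>. So it suffices to find a random path \<open>U\<close>, bounded by \<open>l\<close> and fixed at the
  jumps, whose increments follow the noise: the residuals \<open>Z\<^sub>i - (U\<^sub>i\<^sub>-\<^sub>1 - U\<^sub>i)\<close> must have a small sum of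
  squares in expectation. The path may be built on each constant piece separately.

  On a piece of length \<open>N\<close> let \<open>U\<close> be the random walk driven by the noise, kept inside a tube of half-width
  \<open>H\<close>. Reflecting it at the ends of the tube would cost order \<open>1\<close> at each visit to the ends, which is too
  much. Instead the walk gets a drift away from the ends, of the order of the inverse distance to them,
  as for a Bessel process, and is clipped in the rare cases when this is not enough. With \<open>q\<close> the suitably offset
  product of the distances to the two ends, \<open>ln q\<close> is a Lyapunov function: its expected gain in one step
  exceeds a multiple of the expected squared residual, up to an error of order \<open>1 / H\<^sup>2\<close>
  (\<open>tube_step_energy\<close>). Since \<open>ln q\<close> ranges over an interval of length at most \<open>ln (1 + H)\<close>, the total
  energy is of order \<open>ln (1 + H) + N / H\<^sup>2\<close> (\<open>walk_energy_expectation\<close>).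

  Such a walk is right at its starting point only. Averaging a walk from the left end and one from the right
  end with linearly changing weights gives a path that is right at both ends, at the extra cost \<open>G\<^sup>2 / N\<close> for
  a gap \<open>G\<close> between the two (\<open>exists_bridge\<close>). With \<open>H = min l (sqrt N)\<close> the cost of a piece is then of order
  \<open>1 + ln N + N / l\<^sup>2\<close>, plus \<open>l\<^sup>2 / N\<close> if the signs at its ends differ. Summing over the pieces by concavity of
  the logarithm, and using the lower bound on the lengths of the pieces with a sign change, gives
  \<open>risk_le_of_penalty\<close>.

  It remains to see that the two choices of \<open>l\<close> are not too small. The number \<open>Cs\<close> is an arbitrary constant
  with the defining property, but that property, applied to the vector \<open>(0, 1)\<close>, already gives \<open>Cs \<ge> 1\<close>
  (\<open>is_Cstar_ge_1\<close>). Hence \<open>\<Gamma> \<ge> 1\<close> and the terms \<open>N / l\<^sup>2\<close> add up to at most a multiple of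
  \<open>k + 1\<close>.
\<close>

section \<open>The estimator and the dual bound on its error\<close>

lemma norm2_power2: "(norm2 n x)\<^sup>2 = (\<Sum>i=1..n. (x i)\<^sup>2)"
  unfolding norm2_def L2_set_def by (simp add: sum_nonneg)

lemma tv_eq: "tv n \<theta> = (\<Sum>e=1..n-1. \<bar>\<theta> (e + 1) - \<theta> e\<bar>)"
  unfolding tv_def norm1_def D_def by (intro sum.cong) auto

lemma tv_nonneg: "0 \<le> tv n \<theta>"
  unfolding tv_eq by (intro sum_nonneg) auto

lemma tv_convex:
  assumes "0 \<le> t" "t \<le> 1"
  shows "tv n (\<lambda>i\<in>{1..n}. (1 - t) * a i + t * b i) \<le> (1 - t) * tv n a + t * tv n b"
proof -
  have "tv n (\<lambda>i\<in>{1..n}. (1 - t) * a i + t * b i)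
      = (\<Sum>e=1..n-1. \<bar>(1 - t) * (a (e + 1) - a e) + t * (b (e + 1) - b e)\<bar>)"
    unfolding tv_eq by (intro sum.cong refl arg_cong[where f=abs]) (auto simp: algebra_simps)
  also have "\<dots> \<le> (\<Sum>e=1..n-1. (1 - t) * \<bar>a (e + 1) - a e\<bar> + t * \<bar>b (e + 1) - b e\<bar>)"
    using assms by (intro sum_mono order_trans[OF abs_triangle_ineq]) (auto simp: abs_mult)
  finally show ?thesis unfolding tv_eq by (simp add: sum.distrib sum_distrib_left)
qed

text \<open>Noise level and tuning parameter enter only through their product \<open>\<kappa>\<close>.\<close>

definition tv_objective :: "nat \<Rightarrow> real \<Rightarrow> (nat \<Rightarrow> real) \<Rightarrow> (nat \<Rightarrow> real) \<Rightarrow> real" where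
  "tv_objective n \<kappa> Y \<theta> = 1/2 * (norm2 n (Y - \<theta>))\<^sup>2 + \<kappa> * tv n \<theta>"

lemma tv_objective_attains_min:
  assumes \<kappa>: "0 \<le> \<kappa>"
  shows "\<exists>m\<in>Rn n. \<forall>\<theta>\<in>Rn n. tv_objective n \<kappa> Y m \<le> tv_objective n \<kappa> Y \<theta>"
proof -
  define F where "F = tv_objective n \<kappa> Y"
  define o' :: "nat \<Rightarrow> real" where "o' = (\<lambda>i\<in>{1..n}. 0)"
  define B where "B = 1 + 2 * F o'"
  define K where "K = Pi\<^sub>E UNIV (\<lambda>i. if i \<in> {1..n} then {Y i - B..Y i + B} else {undefined :: real})"
  have o': "o' \<in> Rn n" unfolding o'_def Rn_def by auto
  \<comment> \<open>the sublevel set of o' lies in the compact box K\<close>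
  have inK: "\<theta> \<in> K" if \<theta>: "\<theta> \<in> Rn n" and le: "F \<theta> \<le> F o'" for \<theta>
  proof -
    have "\<bar>Y i - \<theta> i\<bar> \<le> B" if i: "i \<in> {1..n}" for i
    proof -
      have "(Y i - \<theta> i)\<^sup>2 \<le> (\<Sum>i=1..n. ((Y - \<theta>) i)\<^sup>2)"
        using member_le_sum[of i "{1..n}" "\<lambda>i. ((Y - \<theta>) i)\<^sup>2"] i by simp
      also have "\<dots> \<le> 2 * F \<theta>"
        unfolding F_def tv_objective_def norm2_power2 using \<kappa> tv_nonneg[of n \<theta>] by simp
      also have "\<dots> \<le> 2 * F o'" using le by simp
      finally have d: "\<bar>Y i - \<theta> i\<bar>\<^sup>2 \<le> 2 * F o'" by simp
      have "d \<le> B" if "d\<^sup>2 \<le> 2 * F o'" for d :: real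
      proof -
        have "0 \<le> (d - 1)\<^sup>2" by simp
        then have "2 * d \<le> d\<^sup>2 + 1" unfolding power2_diff by simp
        moreover have "0 \<le> d\<^sup>2" by simp
        ultimately show ?thesis using that unfolding B_def by linarith
      qed
      then show ?thesis using d by blast
    qed
    then have *: "\<theta> i \<in> {Y i - B..Y i + B}" if "i \<in> {1..n}" for i
      using that by (simp add: abs_le_iff) (smt (verit))
    have "\<theta> i = undefined" if "i \<notin> {1..n}" for i
      using \<theta> that unfolding Rn_def by (auto simp: PiE_def extensional_def)
    then show ?thesis unfolding K_def using * by auto
  qed
  have KR: "K \<subseteq> Rn n"
    unfolding K_def Rn_def by (auto simp: PiE_iff extensional_def split: if_splits)
  have "compactin (product_topology (\<lambda>_. euclidean) UNIV) K"
    unfolding K_def compactin_PiE by (auto simp: compactin_euclidean_iff)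
  then have "compact K" by (simp add: euclidean_product_topology)
  moreover have "K \<noteq> {}" using inK[OF o'] by auto
  moreover have "continuous_on K F"
    unfolding F_def tv_objective_def norm2_power2 tv_eq
    by (auto intro!: continuous_intros continuous_on_subset[OF continuous_on_product_coordinates])
  ultimately obtain m where m: "m \<in> K" "\<forall>\<theta>\<in>K. F m \<le> F \<theta>"
    using continuous_attains_inf by blast
  have "F m \<le> F \<theta>" if "\<theta> \<in> Rn n" for \<theta>
    using m(2) inK[OF that] inK[OF o'] by (cases "F \<theta> \<le> F o'") force+
  then show ?thesis using m(1) KR unfolding F_def by blast
qed

lemma penalized_estimator_minimizes:
  assumes "0 \<le> \<sigma> * l"
  shows "penalized_estimator n \<sigma> l Y \<in> Rn n"
    and "\<theta> \<in> Rn n \<Longrightarrow> tv_objective n (\<sigma> * l) Y (penalized_estimator n \<sigma> l Y) \<le> tv_objective n (\<sigma> * l) Y \<theta>"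
proof -
  have "is_arg_min (tv_objective n (\<sigma> * l) Y) (\<lambda>x. x \<in> Rn n) (penalized_estimator n \<sigma> l Y)"
    unfolding penalized_estimator_def arg_min_on_def arg_min_def tv_objective_def[symmetric]
    by (rule someI_ex[of "is_arg_min (tv_objective n (\<sigma> * l) Y) (\<lambda>x. x \<in> Rn n)"]) (use tv_objective_attains_min[OF assms, of n Y] in \<open>auto simp: is_arg_min_linorder\<close>)
  then show "penalized_estimator n \<sigma> l Y \<in> Rn n"
    and "\<theta> \<in> Rn n \<Longrightarrow> tv_objective n (\<sigma> * l) Y (penalized_estimator n \<sigma> l Y) \<le> tv_objective n (\<sigma> * l) Y \<theta>"
    by (auto simp: is_arg_min_linorder)
qed

text \<open>First-order optimality without subdifferential calculus: compare the minimiser with the points of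
  the segment towards \<open>\<theta>\<close> near it. Along the segment the penalty is convex, and the quadratic part
  contributes a remainder of order \<open>t\<^sup>2\<close>.\<close>

lemma penalized_estimator_variational:
  fixes Y :: "nat \<Rightarrow> real"
  assumes \<kappa>: "0 \<le> \<sigma> * l" and \<theta>: "\<theta> \<in> Rn n"
  defines "m \<equiv> penalized_estimator n \<sigma> l Y"
  shows "(\<Sum>i=1..n. (Y i - m i) * (\<theta> i - m i)) \<le> \<sigma> * l * (tv n \<theta> - tv n m)"
proof (rule ccontr)
  define A where "A = (\<Sum>i=1..n. (Y i - m i) * (\<theta> i - m i))"
  define B where "B = \<sigma> * l * (tv n \<theta> - tv n m)"
  define S where "S = (\<Sum>i=1..n. (\<theta> i - m i)\<^sup>2)"
  assume "\<not> ?thesis"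
  then have AB: "B < A" unfolding A_def B_def by simp
  have key: "t * (A - B) \<le> t\<^sup>2 / 2 * S" if t: "0 \<le> t" "t \<le> 1" for t
  proof -
    define p where "p = (\<lambda>i\<in>{1..n}. (1 - t) * m i + t * \<theta> i)"
    have "p \<in> Rn n" unfolding p_def Rn_def by auto
    then have "tv_objective n (\<sigma> * l) Y m \<le> tv_objective n (\<sigma> * l) Y p"
      unfolding m_def by (rule penalized_estimator_minimizes(2)[OF \<kappa>])
    moreover have "\<sigma> * l * tv n p \<le> \<sigma> * l * ((1 - t) * tv n m + t * tv n \<theta>)"
      unfolding p_def by (intro mult_left_mono tv_convex t \<kappa>)
    moreover have "(\<Sum>i=1..n. ((Y - p) i)\<^sup>2) = (\<Sum>i=1..n. ((Y - m) i)\<^sup>2) - 2 * t * A + t\<^sup>2 * S"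
    proof -
      have "(\<Sum>i=1..n. ((Y - p) i)\<^sup>2) = (\<Sum>i=1..n. ((Y - m) i)\<^sup>2 - 2 * t * ((Y i - m i) * (\<theta> i - m i)) + t\<^sup>2 * (\<theta> i - m i)\<^sup>2)"
        by (intro sum.cong) (auto simp: p_def power2_eq_square algebra_simps)
      then show ?thesis unfolding A_def S_def by (simp add: sum.distrib sum_subtractf sum_distrib_left)
    qed
    ultimately show ?thesis
      unfolding tv_objective_def norm2_power2 B_def by (simp add: algebra_simps)
  qed
  have S0: "0 \<le> S" unfolding S_def by (simp add: sum_nonneg)
  \<comment> \<open>so small that the quadratic remainder in key cannot make up for the gap A - B\<close>
  define t where "t = min 1 ((A - B) / (S + 1))"
  have t: "0 < t" "t \<le> 1" "t \<le> (A - B) / (S + 1)" unfolding t_def using AB S0 by auto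
  have "A - B \<le> t / 2 * S" using key[of t] t by (simp add: power2_eq_square)
  also have "\<dots> \<le> (A - B) / (S + 1) / 2 * S" using t S0 by (intro mult_right_mono divide_right_mono) auto
  also have "\<dots> = (A - B) * (S / (2 * (S + 1)))" by simp
  also have "\<dots> < (A - B) * 1" using AB S0 by (intro mult_strict_left_mono) auto
  also have "\<dots> = A - B" by simp
  finally show False by simp
qed

text \<open>Expand the sum of the squares of \<open>b i - a i\<close>.\<close>

lemma sum_squares_le_of_le_inner:
  fixes a b :: "'a \<Rightarrow> real"
  assumes "(\<Sum>i\<in>I. (a i)\<^sup>2) \<le> (\<Sum>i\<in>I. b i * a i)"
  shows "(\<Sum>i\<in>I. (a i)\<^sup>2) \<le> (\<Sum>i\<in>I. (b i)\<^sup>2)"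
proof -
  have "0 \<le> (\<Sum>i\<in>I. (b i - a i)\<^sup>2)" by (simp add: sum_nonneg)
  also have "\<dots> = (\<Sum>i\<in>I. (b i)\<^sup>2) - 2 * (\<Sum>i\<in>I. b i * a i) + (\<Sum>i\<in>I. (a i)\<^sup>2)"
    by (simp add: power2_diff sum.distrib sum_subtractf sum_distrib_left algebra_simps)
  finally show ?thesis using assms by linarith
qed

text \<open>Proximal maps are nonexpansive: add the variational inequalities of the two minimisers, each tested
  against the other one. This gives uniqueness of the minimiser, and continuity, on which measurability
  rests.\<close>

lemma penalized_estimator_nonexpansive:
  assumes \<kappa>: "0 \<le> \<sigma> * l"
  shows "(\<Sum>i=1..n. (penalized_estimator n \<sigma> l Y i - penalized_estimator n \<sigma> l Y' i)\<^sup>2)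
     \<le> (\<Sum>i=1..n. (Y i - Y' i)\<^sup>2)"
proof (rule sum_squares_le_of_le_inner)
  let ?m = "penalized_estimator n \<sigma> l Y" and ?m' = "penalized_estimator n \<sigma> l Y'"
  have "(\<Sum>i=1..n. (Y i - ?m i) * (?m' i - ?m i)) + (\<Sum>i=1..n. (Y' i - ?m' i) * (?m i - ?m' i)) \<le> 0"
  proof -
    have "(\<Sum>i=1..n. (Y i - ?m i) * (?m' i - ?m i)) \<le> \<sigma> * l * (tv n ?m' - tv n ?m)"
      and "(\<Sum>i=1..n. (Y' i - ?m' i) * (?m i - ?m' i)) \<le> \<sigma> * l * (tv n ?m - tv n ?m')"
      by (intro penalized_estimator_variational penalized_estimator_minimizes(1) \<kappa>)+
    then show ?thesis by (simp add: algebra_simps)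
  qed
  also have "(\<Sum>i=1..n. (Y i - ?m i) * (?m' i - ?m i)) + (\<Sum>i=1..n. (Y' i - ?m' i) * (?m i - ?m' i))
     = (\<Sum>i=1..n. (?m i - ?m' i)\<^sup>2) - (\<Sum>i=1..n. (Y i - Y' i) * (?m i - ?m' i))"
    unfolding sum.distrib[symmetric] sum_subtractf[symmetric]
    by (intro sum.cong) (auto simp: power2_eq_square algebra_simps)
  finally show "(\<Sum>i=1..n. (?m i - ?m' i)\<^sup>2) \<le> (\<Sum>i=1..n. (Y i - Y' i) * (?m i - ?m' i))"
    by simp
qed

text \<open>The estimator is continuous for the product topology on all functions \<open>nat \<Rightarrow> real\<close>, whose Borel sets
  are those of the product sigma-algebra. The coordinates outside \<open>{1..n}\<close> are first set to \<open>0\<close>, which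
  changes neither the objective nor the estimator.\<close>

lemma measurable_penalized_estimator:
  assumes \<kappa>: "0 \<le> \<sigma> * l" and i: "i \<in> {1..n}"
    and N: "sets N = sets (PiM {1..n} (\<lambda>_. borel))"
  shows "(\<lambda>Y. penalized_estimator n \<sigma> l Y i) \<in> borel_measurable N"
proof -
  define T :: "(nat \<Rightarrow> real) \<Rightarrow> nat \<Rightarrow> real" where "T = (\<lambda>Y j. if j \<in> {1..n} then Y j else 0)"
  have T: "T \<in> borel_measurable (PiM {1..n} (\<lambda>_. borel))"
  proof (rule measurable_coordinatewise_then_product)
    fix j show "(\<lambda>x. T x j) \<in> borel_measurable (Pi\<^sub>M {1..n} (\<lambda>_. borel))"
      unfolding T_def by (cases "j \<in> {1..n}") auto
  qed
  have eq: "penalized_estimator n \<sigma> l (T Y) = penalized_estimator n \<sigma> l Y" for Y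
  proof -
    have "norm2 n (T Y - \<theta>) = norm2 n (Y - \<theta>)" for \<theta>
      unfolding norm2_def by (intro L2_set_cong) (auto simp: T_def)
    then show ?thesis unfolding penalized_estimator_def by simp
  qed
  have "continuous_on UNIV (\<lambda>Y. penalized_estimator n \<sigma> l Y i)"
    unfolding continuous_on_eq_continuous_at[OF open_UNIV] continuous_at
  proof
    fix Y0 :: "nat \<Rightarrow> real"
    let ?d = "\<lambda>Y. sqrt (\<Sum>j=1..n. (Y j - Y0 j)\<^sup>2)"
    have "continuous_on UNIV ?d" by (intro continuous_intros) auto
    then have "(?d \<longlongrightarrow> ?d Y0) (at Y0)"
      unfolding continuous_on_eq_continuous_at[OF open_UNIV] continuous_at by blast
    then have d0: "(?d \<longlongrightarrow> 0) (at Y0)" by simp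
    have "\<bar>penalized_estimator n \<sigma> l Y i - penalized_estimator n \<sigma> l Y0 i\<bar> \<le> ?d Y" for Y
    proof (rule real_le_rsqrt)
      have "\<bar>penalized_estimator n \<sigma> l Y i - penalized_estimator n \<sigma> l Y0 i\<bar>\<^sup>2
         \<le> (\<Sum>j=1..n. (penalized_estimator n \<sigma> l Y j - penalized_estimator n \<sigma> l Y0 j)\<^sup>2)"
        using member_le_sum[of i "{1..n}" "\<lambda>j. (penalized_estimator n \<sigma> l Y j - penalized_estimator n \<sigma> l Y0 j)\<^sup>2"] i by simp
      then show "\<bar>penalized_estimator n \<sigma> l Y i - penalized_estimator n \<sigma> l Y0 i\<bar>\<^sup>2 \<le> (\<Sum>j=1..n. (Y j - Y0 j)\<^sup>2)"
        using penalized_estimator_nonexpansive[OF \<kappa>, of n Y Y0] by linarith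
    qed
    then have "((\<lambda>Y. penalized_estimator n \<sigma> l Y i - penalized_estimator n \<sigma> l Y0 i) \<longlongrightarrow> 0) (at Y0)"
      by (intro Lim_null_comparison[OF _ d0]) auto
    then show "((\<lambda>Y. penalized_estimator n \<sigma> l Y i) \<longlongrightarrow> penalized_estimator n \<sigma> l Y0 i) (at Y0)"
      by (rule Lim_null[THEN iffD2])
  qed
  then have "(\<lambda>Y. penalized_estimator n \<sigma> l Y i) \<in> borel_measurable borel"
    by (rule borel_measurable_continuous_onI)
  then have "(\<lambda>Y. penalized_estimator n \<sigma> l (T Y) i) \<in> borel_measurable (PiM {1..n} (\<lambda>_. borel))"
    by (rule measurable_compose[OF T])
  then show ?thesis unfolding eq using N measurable_cong_sets by blast
qed

lemma sum_by_parts: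
  fixes U h :: "nat \<Rightarrow> real"
  assumes "1 \<le> n" "U 0 = 0" "U n = 0"
  shows "(\<Sum>i=1..n. (U (i - 1) - U i) * h i) = (\<Sum>e=1..n-1. U e * (h (e + 1) - h e))"
proof -
  have "(\<Sum>i=1..m+1. (U (i - 1) - U i) * h i) = (\<Sum>e=1..m. U e * (h (e + 1) - h e)) - U (m + 1) * h (m + 1)" for m
    using assms(2) by (induction m) (auto simp: algebra_simps)
  from this[of "n - 1"] show ?thesis using assms by simp
qed

text \<open>The dual bound. A path \<open>U\<close> on the edges \<open>e\<close> between \<open>e\<close> and \<open>e + 1\<close>, bounded by \<open>l\<close>, equal to \<open>l\<close>
  times the sign at the jumps and \<open>0\<close> at both ends, makes the vector \<open>U (i - 1) - U i\<close> a subgradient of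
  \<open>l * tv n\<close> at \<open>\<theta>\<close>. Monotonicity of the subdifferential then bounds the error by the distance of the noise to \<open>\<sigma>\<close> times this subgradient.
  The path may depend on \<open>Y\<close> in any way.\<close>

lemma squared_error_le_dual:
  assumes n: "1 \<le> n" and \<sigma>: "0 < \<sigma>" and l: "0 \<le> l" and \<theta>: "\<theta> \<in> Rn n"
    and U0: "U 0 = 0" and Un: "U n = 0"
    and Ul: "\<And>e. e \<in> {1..n-1} \<Longrightarrow> \<bar>U e\<bar> \<le> l"
    and Us: "\<And>e. e \<in> {1..n-1} \<Longrightarrow> \<theta> e \<noteq> \<theta> (e + 1) \<Longrightarrow> U e = l * sgn (\<theta> (e + 1) - \<theta> e)"
  shows "squared_error n (penalized_estimator n \<sigma> l) \<theta> Y \<le> (\<Sum>i=1..n. (Y i - \<theta> i - \<sigma> * (U (i - 1) - U i))\<^sup>2)"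
proof -
  define m where "m = penalized_estimator n \<sigma> l Y"
  define h where "h = m - \<theta>"
  have \<kappa>: "0 \<le> \<sigma> * l" using \<sigma> l by simp
  have sub: "(\<Sum>i=1..n. (U (i - 1) - U i) * h i) \<le> l * (tv n m - tv n \<theta>)"
  proof -
    have "(\<Sum>i=1..n. (U (i - 1) - U i) * h i) = (\<Sum>e=1..n-1. U e * (h (e + 1) - h e))"
      by (rule sum_by_parts[OF n U0 Un])
    also have "\<dots> \<le> (\<Sum>e=1..n-1. l * (\<bar>m (e + 1) - m e\<bar> - \<bar>\<theta> (e + 1) - \<theta> e\<bar>))"
    proof (rule sum_mono)
      fix e assume e: "e \<in> {1..n-1}"
      have "U e * (m (e + 1) - m e) \<le> \<bar>U e\<bar> * \<bar>m (e + 1) - m e\<bar>" by (metis abs_ge_self abs_mult)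
      also have "\<dots> \<le> l * \<bar>m (e + 1) - m e\<bar>" using Ul[OF e] by (intro mult_right_mono) auto
      finally have "U e * (m (e + 1) - m e) \<le> l * \<bar>m (e + 1) - m e\<bar>" .
      moreover have "U e * (\<theta> (e + 1) - \<theta> e) = l * \<bar>\<theta> (e + 1) - \<theta> e\<bar>"
        using Us[OF e] by (cases "\<theta> e = \<theta> (e + 1)") (auto simp: sgn_if)
      ultimately show "U e * (h (e + 1) - h e) \<le> l * (\<bar>m (e + 1) - m e\<bar> - \<bar>\<theta> (e + 1) - \<theta> e\<bar>)"
        unfolding h_def by (simp add: algebra_simps)
    qed
    also have "\<dots> = l * (tv n m - tv n \<theta>)" unfolding tv_eq by (simp add: sum_distrib_left sum_subtractf algebra_simps)
    finally show ?thesis .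
  qed
  have "(\<Sum>i=1..n. (Y i - m i) * (\<theta> i - m i)) \<le> - \<sigma> * (l * (tv n m - tv n \<theta>))"
    using penalized_estimator_variational[OF \<kappa> \<theta>, of Y] unfolding m_def by (simp add: algebra_simps)
  also have "\<dots> \<le> - \<sigma> * (\<Sum>i=1..n. (U (i - 1) - U i) * h i)" using sub \<sigma> by simp
  finally have "(\<Sum>i=1..n. (Y i - m i) * (\<theta> i - m i) + \<sigma> * ((U (i - 1) - U i) * h i)) \<le> 0"
    unfolding sum.distrib sum_distrib_left[symmetric] by linarith
  also have "(\<Sum>i=1..n. (Y i - m i) * (\<theta> i - m i) + \<sigma> * ((U (i - 1) - U i) * h i))
     = (\<Sum>i=1..n. (h i)\<^sup>2) - (\<Sum>i=1..n. (Y i - \<theta> i - \<sigma> * (U (i - 1) - U i)) * h i)"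
    unfolding sum_subtractf[symmetric] h_def
    by (intro sum.cong) (auto simp: power2_eq_square algebra_simps)
  finally show ?thesis
    unfolding squared_error_def norm2_power2 m_def[symmetric] h_def[symmetric]
    by (intro sum_squares_le_of_le_inner) simp
qed

section \<open>One step of a random walk in a tube\<close>

definition clip :: "real \<Rightarrow> real \<Rightarrow> real" where
  "clip H y = max (- H) (min H y)"

text \<open>The product of the distances of \<open>x\<close> to the ends of the enlarged interval \<open>{-H-200..H+200}\<close>. Its
  logarithm is the Lyapunov function. The offset \<open>200\<close> is large so that the drift below can have a large
  factor and still have size at most \<open>1\<close>.\<close>

definition wall :: "real \<Rightarrow> real \<Rightarrow> real" where
  "wall H x = (H + 200)\<^sup>2 - x\<^sup>2"

text \<open>\<open>200\<close> times the derivative of \<open>ln (wall H x)\<close>: a repulsion from both ends, of the order of the inverse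
  distance to the nearer end, as for a Bessel process.\<close>

definition push :: "real \<Rightarrow> real \<Rightarrow> real" where
  "push H x = - 400 * x / wall H x"

definition tube_step :: "real \<Rightarrow> real \<Rightarrow> real \<Rightarrow> real" where
  "tube_step H x z = clip H (x + push H x + z)"

lemma wall_ge:
  assumes "\<bar>x\<bar> \<le> H"
  shows "400 * H + 40000 \<le> wall H x"
proof -
  have "x\<^sup>2 \<le> H\<^sup>2" using assms by (rule abs_le_square_iff[THEN iffD1, OF order_trans]) simp
  then show ?thesis unfolding wall_def by (simp add: power2_eq_square algebra_simps)
qed

lemma wall_le: "wall H x \<le> (H + 200)\<^sup>2"
  unfolding wall_def by simp

lemma wall_factor: "wall H x = (H + 200 - \<bar>x\<bar>) * (H + 200 + \<bar>x\<bar>)"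
  unfolding wall_def by (simp add: power2_eq_square algebra_simps)

lemma abs_clip_le: "0 \<le> H \<Longrightarrow> \<bar>clip H y\<bar> \<le> H"
  unfolding clip_def by auto

lemma abs_tube_step_le: "0 \<le> H \<Longrightarrow> \<bar>tube_step H x z\<bar> \<le> H"
  unfolding tube_step_def by (rule abs_clip_le)

lemma abs_push_le_1:
  assumes "\<bar>x\<bar> \<le> H"
  shows "\<bar>push H x\<bar> \<le> 1"
proof -
  have "400 * \<bar>x\<bar> \<le> wall H x" using wall_ge[OF assms] assms by linarith
  moreover have "0 < wall H x" using wall_ge[OF assms] assms by linarith
  ultimately show ?thesis unfolding push_def by (simp add: abs_mult)
qed

lemma abs_add_push_le:
  assumes "\<bar>x\<bar> \<le> H"
  shows "\<bar>x + push H x\<bar> \<le> \<bar>x\<bar>"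
proof -
  define t where "t = 400 / wall H x"
  have w: "400 \<le> wall H x" using wall_ge[OF assms] assms by linarith
  then have t: "0 \<le> t" "t \<le> 1" unfolding t_def by auto
  have "x + push H x = (1 - t) * x" unfolding push_def t_def by (simp add: algebra_simps)
  then have "\<bar>x + push H x\<bar> = (1 - t) * \<bar>x\<bar>" using t by (simp add: abs_mult)
  also have "\<dots> \<le> 1 * \<bar>x\<bar>" using t by (intro mult_right_mono) auto
  finally show ?thesis by simp
qed

lemma abs_tube_step_diff:
  assumes "\<bar>x\<bar> \<le> H"
  shows "\<bar>tube_step H x z - x\<bar> \<le> 1 + \<bar>z\<bar>"
  using abs_push_le_1[OF assms] assms unfolding tube_step_def clip_def by (auto simp: abs_if max_def min_def split: if_splits)

lemma wall_tube_step_ge: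
  assumes "0 \<le> H"
  shows "wall H (x + push H x + z) \<le> wall H (tube_step H x z)"
proof -
  have "\<bar>tube_step H x z\<bar> \<le> \<bar>x + push H x + z\<bar>"
    using assms unfolding tube_step_def clip_def by (auto simp: abs_if max_def min_def)
  then show ?thesis unfolding wall_def by (simp add: abs_le_square_iff)
qed

text \<open>A second-order Taylor bound. From \<open>ln y \<ge> 1 - 1 / y\<close> the increment of \<open>ln\<close> is at least
  \<open>(q' - q) / q - (q' - q)\<^sup>2 / (q q')\<close>. The remainder is harmless because \<open>q\<close> is at most a multiple of
  \<open>q'\<close> that is linear in the size of the step. Clipping moves towards the centre and only increases \<open>q'\<close>.\<close>

lemma ln_wall_increment:
  assumes H: "1 \<le> H" and x: "\<bar>x\<bar> \<le> H"
  defines "q \<equiv> wall H x" and "g \<equiv> push H x"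
  shows "(- 2 * x * (g + z) - (g + z)\<^sup>2) / q
           - 128 * (1 + z\<^sup>2)\<^sup>2 * (x\<^sup>2 / q\<^sup>2) - 64 * (1 + z\<^sup>2)^3 / H\<^sup>2
         \<le> ln (wall H (tube_step H x z)) - ln q"
proof -
  define x' where "x' = tube_step H x z"
  define q' where "q' = wall H x'"
  define e where "e = 1 + \<bar>z\<bar>"
  have x': "\<bar>x'\<bar> \<le> H" unfolding x'_def using H by (intro abs_tube_step_le) auto
  have d: "\<bar>x' - x\<bar> \<le> e" unfolding x'_def e_def by (rule abs_tube_step_diff[OF x])
  have e1: "1 \<le> e" unfolding e_def by simp
  have q: "H \<le> q" "0 < q" unfolding q_def using wall_ge[OF x] H by linarith+
  have q'0: "0 < q'" unfolding q'_def using wall_ge[OF x'] H by linarith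
  have qq': "q \<le> 2 * (1 + e) * q'"
  proof -
    have "(H + 200 - \<bar>x\<bar>) \<le> (1 + e) * (H + 200 - \<bar>x'\<bar>)"
    proof -
      have "e * 1 \<le> e * (H + 200 - \<bar>x'\<bar>)" using x' e1 by (intro mult_left_mono) auto
      then show ?thesis using d by (simp add: algebra_simps)
    qed
    moreover have "(H + 200 + \<bar>x\<bar>) \<le> 2 * (H + 200 + \<bar>x'\<bar>)" using x H abs_ge_zero[of x'] unfolding distrib_left by linarith
    ultimately have "(H + 200 - \<bar>x\<bar>) * (H + 200 + \<bar>x\<bar>)
        \<le> ((1 + e) * (H + 200 - \<bar>x'\<bar>)) * (2 * (H + 200 + \<bar>x'\<bar>))"
      using x x' e1 H by (intro mult_mono) auto
    then show ?thesis unfolding q_def q'_def wall_factor by (simp add: algebra_simps)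
  qed
  have e2: "e\<^sup>2 \<le> 2 * (1 + z\<^sup>2)"
    unfolding e_def using sum_squares_ge_zero[of "1 - \<bar>z\<bar>" 0]
    by (simp add: power2_eq_square algebra_simps)
  have e4: "(1 + e) * e\<^sup>2 \<le> 8 * (1 + z\<^sup>2)\<^sup>2"
  proof -
    have "(1 + e) * e\<^sup>2 \<le> (2 * e\<^sup>2) * e\<^sup>2"
      using e1 self_le_power[of e 2] by (intro mult_right_mono) auto
    also have "\<dots> \<le> (2 * (2 * (1 + z\<^sup>2))) * (2 * (1 + z\<^sup>2))"
      using e2 by (intro mult_mono) auto
    finally show ?thesis by (simp add: power2_eq_square algebra_simps)
  qed
  have e6: "(1 + e) * e^4 \<le> 16 * (1 + z\<^sup>2)^3"
  proof -
    have "(1 + e) * e^4 = ((1 + e) * e\<^sup>2) * e\<^sup>2" by (simp add: power_numeral_reduce algebra_simps)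
    also have "\<dots> \<le> (8 * (1 + z\<^sup>2)\<^sup>2) * (2 * (1 + z\<^sup>2))"
      using e4 e2 by (rule mult_mono) auto
    finally show ?thesis by (simp add: power_numeral_reduce algebra_simps)
  qed
  have sq: "(q' - q)\<^sup>2 \<le> 8 * x\<^sup>2 * e\<^sup>2 + 2 * e^4"
  proof -
    have "q' - q = (x - x') * (x + x')" unfolding q_def q'_def wall_def by (simp add: power2_eq_square algebra_simps)
    then have "\<bar>q' - q\<bar> = \<bar>x' - x\<bar> * \<bar>x + x'\<bar>" by (simp add: abs_mult abs_minus_commute)
    also have "\<dots> \<le> e * (2 * \<bar>x\<bar> + e)" using d e1 by (intro mult_mono) auto
    finally have "\<bar>q' - q\<bar> \<le> \<bar>e * (2 * \<bar>x\<bar> + e)\<bar>" by linarith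
    then have "(q' - q)\<^sup>2 \<le> (e * (2 * \<bar>x\<bar> + e))\<^sup>2" by (rule abs_le_square_iff[THEN iffD1])
    also have "\<dots> = e\<^sup>2 * (2 * \<bar>x\<bar> + e)\<^sup>2" by (simp add: power_mult_distrib)
    also have "\<dots> \<le> e\<^sup>2 * (8 * x\<^sup>2 + 2 * e\<^sup>2)"
    proof (intro mult_left_mono)
      have "0 \<le> (2 * \<bar>x\<bar> - e)\<^sup>2" by simp
      then show "(2 * \<bar>x\<bar> + e)\<^sup>2 \<le> 8 * x\<^sup>2 + 2 * e\<^sup>2" by (simp add: power2_eq_square algebra_simps)
    qed simp
    finally show ?thesis by (simp add: power_numeral_reduce algebra_simps)
  qed
  have rem: "(q' - q)\<^sup>2 / (q * q') \<le> 128 * (1 + z\<^sup>2)\<^sup>2 * (x\<^sup>2 / q\<^sup>2) + 64 * (1 + z\<^sup>2)^3 / H\<^sup>2"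
  proof -
    have "1 / q' \<le> 2 * (1 + e) / q" using qq' q q'0 by (simp add: field_simps)
    then have "(q' - q)\<^sup>2 / q * (1 / q') \<le> (q' - q)\<^sup>2 / q * (2 * (1 + e) / q)"
      using q by (intro mult_left_mono) auto
    then have "(q' - q)\<^sup>2 / (q * q') \<le> (q' - q)\<^sup>2 * (2 * (1 + e) / q\<^sup>2)"
      by (simp add: power2_eq_square)
    also have "\<dots> \<le> (8 * x\<^sup>2 * e\<^sup>2 + 2 * e^4) * (2 * (1 + e) / q\<^sup>2)"
      using sq e1 by (intro mult_right_mono) auto
    also have "\<dots> = 16 * ((1 + e) * e\<^sup>2) * (x\<^sup>2 / q\<^sup>2) + 4 * ((1 + e) * e^4) / q\<^sup>2"
      using q by (simp add: field_simps)
    also have "\<dots> \<le> 16 * (8 * (1 + z\<^sup>2)\<^sup>2) * (x\<^sup>2 / q\<^sup>2) + 4 * (16 * (1 + z\<^sup>2)^3) / H\<^sup>2"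
      using e4 e6 q H e1 by (intro add_mono mult_right_mono frac_le mult_left_mono power_mono) auto
    finally show ?thesis by simp
  qed
  have up: "- 2 * x * (g + z) - (g + z)\<^sup>2 \<le> q' - q"
    using wall_tube_step_ge[of H x z] H
    unfolding q'_def x'_def q_def g_def wall_def by (simp add: power2_eq_square algebra_simps)
  have "ln (q / q') \<le> q / q' - 1" using q q'0 by (intro ln_le_minus_one) auto
  then have "ln q' - ln q \<ge> 1 - q / q'" using q q'0 by (simp add: ln_div)
  moreover have "1 - q / q' = (q' - q) / q - (q' - q)\<^sup>2 / (q * q')"
    using q q'0 by (simp add: field_simps power2_eq_square)
  moreover have "(- 2 * x * (g + z) - (g + z)\<^sup>2) / q \<le> (q' - q) / q"
    using up q by (intro divide_right_mono) auto
  ultimately show ?thesis using rem unfolding q'_def x'_def by linarith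
qed

text \<open>The residual of a step is the drift plus the part that is clipped off. Clipping needs a noise larger
  than the distance \<open>\<delta>\<close> to the end of the tube, so the overshoot carries a factor \<open>1 / (1 + \<delta>)\<close>, which is again
  of the order of the drift near the ends and of order \<open>1 / H\<close> in the middle.\<close>

lemma tube_step_residual:
  assumes H: "1 \<le> H" and x: "\<bar>x\<bar> \<le> H"
  shows "(tube_step H x z - x - z)\<^sup>2
    \<le> 320000 * (x\<^sup>2 / (wall H x)\<^sup>2) + 4 * (1 + z\<^sup>2)\<^sup>2 * (80800\<^sup>2 * (x\<^sup>2 / (wall H x)\<^sup>2) + 4 / H\<^sup>2)"
proof -
  define q where "q = wall H x"
  define \<delta> where "\<delta> = H - \<bar>x\<bar>"
  define o' where "o' = tube_step H x z - (x + push H x + z)"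
  have d0: "0 \<le> \<delta>" unfolding \<delta>_def using x by simp
  have q0: "0 < q" unfolding q_def using wall_ge[OF x] H by linarith
  have o_le: "\<bar>o'\<bar> \<le> \<bar>z\<bar> * (1 + \<bar>z\<bar>) / (1 + \<delta>)"
  proof (cases "\<bar>z\<bar> \<le> \<delta>")
    case True
    then have "o' = 0" using abs_add_push_le[OF x]
      unfolding o'_def tube_step_def clip_def \<delta>_def by (auto simp: abs_if max_def min_def split: if_splits)
    then show ?thesis using d0 by simp
  next
    case False
    have "\<bar>o'\<bar> \<le> \<bar>z\<bar> - \<delta>" using abs_add_push_le[OF x] x H False
      unfolding o'_def tube_step_def clip_def \<delta>_def by (auto simp: abs_if max_def min_def split: if_splits)
    then have "\<bar>o'\<bar> \<le> \<bar>z\<bar>" using d0 by linarith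
    also have "\<bar>z\<bar> * 1 \<le> \<bar>z\<bar> * ((1 + \<bar>z\<bar>) / (1 + \<delta>))" using False d0 by (intro mult_left_mono) auto
    finally show ?thesis by simp
  qed
  have o2: "o'\<^sup>2 \<le> 2 * (1 + z\<^sup>2)\<^sup>2 * (1 / (1 + \<delta>)\<^sup>2)"
  proof -
    have "\<bar>o'\<bar> \<le> \<bar>\<bar>z\<bar> * (1 + \<bar>z\<bar>) / (1 + \<delta>)\<bar>" using o_le by linarith
    then have "o'\<^sup>2 \<le> (\<bar>z\<bar> * (1 + \<bar>z\<bar>) / (1 + \<delta>))\<^sup>2" by (rule abs_le_square_iff[THEN iffD1])
    also have "\<dots> = (z\<^sup>2 * (1 + \<bar>z\<bar>)\<^sup>2) * (1 / (1 + \<delta>)\<^sup>2)" by (simp add: power_mult_distrib power_divide)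
    also have "\<dots> \<le> (2 * ((1 + z\<^sup>2) * (1 + z\<^sup>2))) * (1 / (1 + \<delta>)\<^sup>2)"
      unfolding mult.left_commute[of 2 "1 + z\<^sup>2" "1 + z\<^sup>2"]
    proof (intro mult_right_mono mult_mono)
      have "0 \<le> (1 - \<bar>z\<bar>)\<^sup>2" by simp
      then show "(1 + \<bar>z\<bar>)\<^sup>2 \<le> 2 * (1 + z\<^sup>2)" by (simp add: power2_eq_square algebra_simps)
    qed auto
    finally show ?thesis by (simp add: power2_eq_square)
  qed
  have del: "1 / (1 + \<delta>)\<^sup>2 \<le> 80800\<^sup>2 * (x\<^sup>2 / q\<^sup>2) + 4 / H\<^sup>2"
  proof (cases "\<bar>x\<bar> < H / 2")
    case True
    then have "1 / (1 + \<delta>)\<^sup>2 \<le> 1 / (H/2)\<^sup>2" using H unfolding \<delta>_def by (intro divide_left_mono power_mono) auto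
    also have "\<dots> = 4 / H\<^sup>2" by (simp add: power_divide)
    finally show ?thesis using q0 by (simp add: add_increasing)
  next
    case False
    have "q = (\<delta> + 200) * (H + 200 + \<bar>x\<bar>)" unfolding q_def wall_factor \<delta>_def by (simp add: algebra_simps)
    also have "\<dots> \<le> (200 * (1 + \<delta>)) * (404 * \<bar>x\<bar>)" using d0 False H x by (intro mult_mono) auto
    finally have "1 / (1 + \<delta>) \<le> 80800 * \<bar>x\<bar> / q" using q0 d0 by (simp add: field_simps)
    then have "(1 / (1 + \<delta>))\<^sup>2 \<le> (80800 * \<bar>x\<bar> / q)\<^sup>2" using d0 by (intro power_mono) auto
    then have "1 / (1 + \<delta>)\<^sup>2 \<le> 80800\<^sup>2 * (x\<^sup>2 / q\<^sup>2)" by (simp add: power_divide power_mult_distrib)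
    then show ?thesis using H by (simp add: add_increasing2)
  qed
  have "tube_step H x z - x - z = push H x + o'" unfolding o'_def by simp
  also have "(push H x + o')\<^sup>2 \<le> 2 * (push H x)\<^sup>2 + 2 * o'\<^sup>2"
    using sum_squares_ge_zero[of "push H x - o'" 0] by (simp add: power2_eq_square algebra_simps)
  also have "2 * (push H x)\<^sup>2 = 320000 * (x\<^sup>2 / q\<^sup>2)" unfolding push_def q_def by (simp add: power_divide power_mult_distrib)
  also have "2 * o'\<^sup>2 \<le> 4 * (1 + z\<^sup>2)\<^sup>2 * (1 / (1 + \<delta>)\<^sup>2)" using o2 by simp
  also have "\<dots> \<le> 4 * (1 + z\<^sup>2)\<^sup>2 * (80800\<^sup>2 * (x\<^sup>2 / q\<^sup>2) + 4 / H\<^sup>2)"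
    using del by (intro mult_left_mono) auto
  finally show ?thesis unfolding q_def by simp
qed

text \<open>All that the Taylor bounds below use about a standard normal variable.\<close>

definition standard_gaussian_moments :: "real measure \<Rightarrow> (real \<Rightarrow> real) \<Rightarrow> bool" where
  "standard_gaussian_moments M X \<longleftrightarrow> prob_space M \<and> X \<in> borel_measurable M \<and>
     has_bochner_integral M X 0 \<and> has_bochner_integral M (\<lambda>y. X y ^ 2) 1 \<and>
     has_bochner_integral M (\<lambda>y. X y ^ 4) 3 \<and> has_bochner_integral M (\<lambda>y. X y ^ 6) 15"

lemma normal_standard_moments:
  assumes s: "0 < \<sigma>" and c: "c = 1 \<or> c = -1"
  shows "standard_gaussian_moments (density lborel (\<lambda>x. ennreal (normal_density \<mu> \<sigma> x))) (\<lambda>y. c * ((y - \<mu>) / \<sigma>))"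
proof -
  let ?M = "density lborel (\<lambda>x. ennreal (normal_density \<mu> \<sigma> x))"
  have ev: "has_bochner_integral ?M (\<lambda>y. (c * ((y - \<mu>) / \<sigma>)) ^ (2 * k)) (fact (2 * k) / (2 ^ k * fact k))" for k
  proof -
    have "has_bochner_integral lborel (\<lambda>x. (1 / \<sigma> ^ (2*k)) * (normal_density \<mu> \<sigma> x * (x - \<mu>) ^ (2 * k)))
        ((1 / \<sigma> ^ (2*k)) * (fact (2 * k) / ((2 / \<sigma>\<^sup>2)^k * fact k)))"
      using normal_moment_even[OF s, of \<mu> k] by (intro has_bochner_integral_mult_right) auto
    also have "(1 / \<sigma> ^ (2*k)) * (fact (2 * k) / ((2 / \<sigma>\<^sup>2)^k * fact k)) = fact (2 * k) / (2 ^ k * fact k)"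
      using s by (simp add: power_divide power_mult)
    also have "(\<lambda>x. (1 / \<sigma> ^ (2*k)) * (normal_density \<mu> \<sigma> x * (x - \<mu>) ^ (2 * k)))
       = (\<lambda>x. normal_density \<mu> \<sigma> x *\<^sub>R (c * ((x - \<mu>) / \<sigma>)) ^ (2 * k))"
      using c by (auto simp: power_mult_distrib power_divide fun_eq_iff)
    finally show ?thesis by (intro has_bochner_integral_density) auto
  qed
  have odd: "has_bochner_integral ?M (\<lambda>y. c * ((y - \<mu>) / \<sigma>)) 0"
  proof -
    have "has_bochner_integral lborel (\<lambda>x. (c / \<sigma>) * (normal_density \<mu> \<sigma> x * (x - \<mu>) ^ (2 * 0 + 1))) ((c / \<sigma>) * 0)"
      using normal_moment_odd[OF s, of \<mu> 0] by (intro has_bochner_integral_mult_right) auto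
    then have "has_bochner_integral lborel (\<lambda>x. normal_density \<mu> \<sigma> x *\<^sub>R (c * ((x - \<mu>) / \<sigma>))) 0"
      by (simp add: mult_ac)
    then show ?thesis by (intro has_bochner_integral_density) auto
  qed
  show ?thesis
    unfolding standard_gaussian_moments_def
    using odd ev[of 1] ev[of 2] ev[of 3] prob_space_normal_density[OF s]
    by (auto simp: fact_numeral)
qed

text \<open>The expected gain of the Lyapunov function. The drift contributes \<open>800 x\<^sup>2 / q\<^sup>2\<close>, and this beats the
  remainder of the Taylor bound: since the drift has size at most \<open>1\<close>, the coefficients of the
  remainder do not grow with the strength of the drift. The term \<open>1 / q\<close> from the variance of the noise is at
  most \<open>x\<^sup>2 / q\<^sup>2\<close> if \<open>q \<le> x\<^sup>2\<close>, which is the case near the ends of a wide tube, and at most \<open>2 / H\<^sup>2\<close>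
  elsewhere.\<close>

lemma tube_step_drift:
  assumes M: "standard_gaussian_moments M X" and H: "1 \<le> H" and x: "\<bar>x\<bar> \<le> H"
  shows "x\<^sup>2 / (wall H x)\<^sup>2 - 1794 / H\<^sup>2
     \<le> (\<integral>y. ln (wall H (tube_step H x (X y))) \<partial>M) - ln (wall H x)"
proof -
  interpret prob_space M using M unfolding standard_gaussian_moments_def by auto
  have [measurable]: "X \<in> borel_measurable M" using M unfolding standard_gaussian_moments_def by auto
  have hb: "has_bochner_integral M X 0" "has_bochner_integral M (\<lambda>y. X y ^ 2) 1"
     "has_bochner_integral M (\<lambda>y. X y ^ 4) 3" "has_bochner_integral M (\<lambda>y. X y ^ 6) 15"
    using M unfolding standard_gaussian_moments_def by auto
  have one: "has_bochner_integral M (\<lambda>y. 1::real) 1"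
    by (simp add: has_bochner_integral_iff prob_space)
  define q where "q = wall H x"
  define g where "g = push H x"
  define t where "t = x\<^sup>2 / q\<^sup>2"
  have q: "400 * H + 40000 \<le> q" unfolding q_def by (rule wall_ge[OF x])
  \<comment> \<open>E (1 + X^2)^2 = 6 and E (1 + X^2)^3 = 28\<close>
  have low: "has_bochner_integral M
     (\<lambda>y. (- 2 * x * (g + X y) - (g + X y)\<^sup>2) / q - 128 * (1 + (X y)\<^sup>2)\<^sup>2 * t - 64 * (1 + (X y)\<^sup>2)^3 / H\<^sup>2)
     ((- 2 * x * g - g\<^sup>2 - 1) / q - 768 * t - 1792 / H\<^sup>2)"
  proof -
    have "has_bochner_integral M
      (\<lambda>y. ((- 2 * x * g - g\<^sup>2) / q - 128 * t - 64 / H\<^sup>2) * 1 + ((- 2 * x - 2 * g) / q) * X y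
          + (- 1 / q - 256 * t - 192 / H\<^sup>2) * X y ^ 2 + (- 128 * t - 192 / H\<^sup>2) * X y ^ 4 + (- 64 / H\<^sup>2) * X y ^ 6)
      (((- 2 * x * g - g\<^sup>2) / q - 128 * t - 64 / H\<^sup>2) * 1 + ((- 2 * x - 2 * g) / q) * 0
          + (- 1 / q - 256 * t - 192 / H\<^sup>2) * 1 + (- 128 * t - 192 / H\<^sup>2) * 3 + (- 64 / H\<^sup>2) * 15)"
      by (intro has_bochner_integral_add has_bochner_integral_mult_right hb one)
    also have "(\<lambda>y. ((- 2 * x * g - g\<^sup>2) / q - 128 * t - 64 / H\<^sup>2) * 1 + ((- 2 * x - 2 * g) / q) * X y
          + (- 1 / q - 256 * t - 192 / H\<^sup>2) * X y ^ 2 + (- 128 * t - 192 / H\<^sup>2) * X y ^ 4 + (- 64 / H\<^sup>2) * X y ^ 6)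
      = (\<lambda>y. (- 2 * x * (g + X y) - (g + X y)\<^sup>2) / q - 128 * (1 + (X y)\<^sup>2)\<^sup>2 * t - 64 * (1 + (X y)\<^sup>2)^3 / H\<^sup>2)"
      by (simp add: fun_eq_iff algebra_simps power_numeral_reduce diff_divide_distrib add_divide_distrib)
    also have "(((- 2 * x * g - g\<^sup>2) / q - 128 * t - 64 / H\<^sup>2) * 1 + ((- 2 * x - 2 * g) / q) * 0
          + (- 1 / q - 256 * t - 192 / H\<^sup>2) * 1 + (- 128 * t - 192 / H\<^sup>2) * 3 + (- 64 / H\<^sup>2) * 15)
      = (- 2 * x * g - g\<^sup>2 - 1) / q - 768 * t - 1792 / H\<^sup>2"
      by (simp add: algebra_simps diff_divide_distrib add_divide_distrib)
    finally show ?thesis .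
  qed
  have bd: "\<bar>ln (wall H (tube_step H x z))\<bar> \<le> ln ((H + 200)\<^sup>2)" for z
  proof -
    have "400 * H + 40000 \<le> wall H (tube_step H x z)"
      by (rule wall_ge, rule abs_tube_step_le) (use H in auto)
    then have "1 \<le> wall H (tube_step H x z)" using H by linarith
    moreover from this have "ln (wall H (tube_step H x z)) \<le> ln ((H + 200)\<^sup>2)"
      using wall_le[of H "tube_step H x z"] by (intro ln_mono) auto
    ultimately show ?thesis by (subst abs_of_nonneg) auto
  qed
  have int: "integrable M (\<lambda>y. ln (wall H (tube_step H x (X y))))"
    by (rule integrable_const_bound[where B="ln ((H + 200)\<^sup>2)"])
       (use bd in \<open>auto simp: wall_def tube_step_def clip_def\<close>)
  have "(- 2 * x * g - g\<^sup>2 - 1) / q - 768 * t - 1792 / H\<^sup>2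
     \<le> (\<integral>y. ln (wall H (tube_step H x (X y))) - ln q \<partial>M)"
    unfolding has_bochner_integral_integral_eq[OF low, symmetric]
    by (intro integral_mono)
       (use low int ln_wall_increment[OF H x] in \<open>auto simp: has_bochner_integral_iff t_def q_def g_def\<close>)
  also have "\<dots> = (\<integral>y. ln (wall H (tube_step H x (X y))) \<partial>M) - ln q"
    using int by (simp add: prob_space)
  finally have 1: "(- 2 * x * g - g\<^sup>2 - 1) / q - 768 * t - 1792 / H\<^sup>2
     \<le> (\<integral>y. ln (wall H (tube_step H x (X y))) \<partial>M) - ln q" .
  have "(- 2 * x * g - g\<^sup>2 - 1) / q = 800 * t - 160000 * t / q - 1 / q"
    using q H unfolding g_def push_def t_def q_def[symmetric]
    by (simp add: field_simps power2_eq_square)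
  moreover have "160000 * t / q \<le> 4 * t"
  proof -
    have "160000 / q \<le> 4" using q H by (simp add: field_simps)
    then have "160000 / q * t \<le> 4 * t" unfolding t_def by (intro mult_right_mono) auto
    then show ?thesis by simp
  qed
  moreover have "1 / q \<le> t + 2 / H\<^sup>2"
  proof (cases "q \<le> x\<^sup>2")
    case True
    then have "1 / q \<le> t" unfolding t_def using q H by (simp add: field_simps power2_eq_square)
    then show ?thesis by (simp add: add_increasing2)
  next
    case False
    then have "H\<^sup>2 / 2 \<le> q" unfolding q_def wall_def using H by (simp add: power2_eq_square algebra_simps)
    then have "1 / q \<le> 2 / H\<^sup>2" using H q by (simp add: field_simps)
    then show ?thesis unfolding t_def by (simp add: add_increasing)
  qed
  moreover have "0 \<le> t" unfolding t_def by simp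
  ultimately show ?thesis using 1 unfolding q_def[symmetric] t_def[symmetric] by (simp add: field_simps)
qed

definition energy_const :: real where
  "energy_const = 320000 + 24 * 80800\<^sup>2"

text \<open>Up to an error of order \<open>1 / H\<^sup>2\<close>, the residual is bounded above and the gain of the Lyapunov function
  is bounded below by a multiple of the same quantity \<open>x\<^sup>2 / q\<^sup>2\<close>, the squared drift.\<close>

lemma tube_step_energy:
  assumes M: "standard_gaussian_moments M X" and H: "1 \<le> H" and x: "\<bar>x\<bar> \<le> H"
  shows "integrable M (\<lambda>y. (tube_step H x (X y) - x - X y)\<^sup>2)" (is "integrable M ?r")
    and "(\<integral>y. (tube_step H x (X y) - x - X y)\<^sup>2 \<partial>M)
     \<le> energy_const * ((\<integral>y. ln (wall H (tube_step H x (X y))) \<partial>M) - ln (wall H x)) + 1800 * energy_const / H\<^sup>2"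
proof -
  interpret prob_space M using M unfolding standard_gaussian_moments_def by auto
  have [measurable]: "X \<in> borel_measurable M" using M unfolding standard_gaussian_moments_def by auto
  have hb: "has_bochner_integral M X 0" "has_bochner_integral M (\<lambda>y. X y ^ 2) 1"
     "has_bochner_integral M (\<lambda>y. X y ^ 4) 3" "has_bochner_integral M (\<lambda>y. X y ^ 6) 15"
    using M unfolding standard_gaussian_moments_def by auto
  have one: "has_bochner_integral M (\<lambda>y. 1::real) 1"
    by (simp add: has_bochner_integral_iff prob_space)
  define t where "t = x\<^sup>2 / (wall H x)\<^sup>2"
  define K :: real where "K = 80800\<^sup>2"
  \<comment> \<open>E (1 + X^2)^2 = 6\<close>
  have up: "has_bochner_integral M
     (\<lambda>y. 320000 * t + 4 * (1 + (X y)\<^sup>2)\<^sup>2 * (K * t + 4 / H\<^sup>2))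
     (320000 * t + 24 * (K * t + 4 / H\<^sup>2))"
  proof -
    have "has_bochner_integral M
     (\<lambda>y. (320000 * t + 4 * (K * t + 4 / H\<^sup>2)) * 1 + (8 * (K * t + 4 / H\<^sup>2)) * X y ^ 2 + (4 * (K * t + 4 / H\<^sup>2)) * X y ^ 4)
     ((320000 * t + 4 * (K * t + 4 / H\<^sup>2)) * 1 + (8 * (K * t + 4 / H\<^sup>2)) * 1 + (4 * (K * t + 4 / H\<^sup>2)) * 3)"
      by (intro has_bochner_integral_add has_bochner_integral_mult_right hb one)
    then show ?thesis by (simp add: algebra_simps power_numeral_reduce)
  qed
  have le: "?r y \<le> 320000 * t + 4 * (1 + (X y)\<^sup>2)\<^sup>2 * (K * t + 4 / H\<^sup>2)" for y
    using tube_step_residual[OF H x] unfolding t_def K_def by simp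
  show int: "integrable M ?r"
    by (rule Bochner_Integration.integrable_bound[OF integrable.intros[OF up]])
       (use le in \<open>auto intro!: AE_I2 order_trans[OF _ abs_ge_self] simp: tube_step_def clip_def\<close>)
  have "(\<integral>y. ?r y \<partial>M) \<le> 320000 * t + 24 * (K * t + 4 / H\<^sup>2)"
    unfolding has_bochner_integral_integral_eq[OF up, symmetric]
    using int up le by (intro integral_mono) (auto simp: has_bochner_integral_iff)
  also have "\<dots> = energy_const * t + 96 / H\<^sup>2" unfolding energy_const_def K_def by (simp add: algebra_simps)
  also have "\<dots> \<le> energy_const * ((\<integral>y. ln (wall H (tube_step H x (X y))) \<partial>M) - ln (wall H x) + 1794 / H\<^sup>2)
       + energy_const / H\<^sup>2"
  proof (intro add_mono mult_left_mono divide_right_mono)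
    show "t \<le> (\<integral>y. ln (wall H (tube_step H x (X y))) \<partial>M) - ln (wall H x) + 1794 / H\<^sup>2"
      using tube_step_drift[OF M H x] unfolding t_def by linarith
  qed (auto simp: energy_const_def)
  also have "\<dots> \<le> energy_const * ((\<integral>y. ln (wall H (tube_step H x (X y))) \<partial>M) - ln (wall H x)) + 1800 * energy_const / H\<^sup>2"
  proof -
    have "energy_const * 1794 / H\<^sup>2 + energy_const / H\<^sup>2 \<le> 1800 * energy_const / H\<^sup>2"
      using H unfolding energy_const_def by (simp add: field_simps)
    then show ?thesis by (simp add: algebra_simps)
  qed
  finally show "(\<integral>y. ?r y \<partial>M)
     \<le> energy_const * ((\<integral>y. ln (wall H (tube_step H x (X y))) \<partial>M) - ln (wall H x)) + 1800 * energy_const / H\<^sup>2" .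
qed

section \<open>The energy of the walk\<close>

text \<open>Resampling one coordinate does not change the expectation. This is how one conditions on all other
  coordinates.\<close>

lemma (in product_prob_space) integral_resample:
  fixes f :: "('i \<Rightarrow> 'a) \<Rightarrow> real"
  assumes I: "finite I" "i \<in> I" and f: "integrable (PiM I M) f"
  shows "integral\<^sup>L (PiM I M) f = (\<integral>x. (\<integral>y. f (x(i := y)) \<partial>M i) \<partial>PiM I M)"
proof -
  define J where "J = I - {i}"
  have J: "finite J" "i \<notin> J" "insert i J = I" "J \<subseteq> I" using I unfolding J_def by auto
  have [measurable]: "f \<in> borel_measurable (PiM (insert i J) M)" using f J by auto
  define h where "h = (\<lambda>x. \<integral>y. f (x(i := y)) \<partial>M i)"
  have h: "h \<in> borel_measurable (PiM J M)" unfolding h_def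
    by measurable
  have "integral\<^sup>L (PiM I M) f = (\<integral>x. h x \<partial>PiM J M)"
    unfolding h_def using product_integral_insert[OF J(1,2)] f J(3) by simp
  also have "\<dots> = (\<integral>x. h x \<partial>distr (PiM I M) (PiM J M) (\<lambda>x. restrict x J))"
    using distr_PiM_restrict_finite[OF J(1) J(4)] by simp
  also have "\<dots> = (\<integral>x. h (restrict x J) \<partial>PiM I M)"
    using h J(4) by (intro integral_distr measurable_restrict_subset) auto
  also have "\<dots> = (\<integral>x. h x \<partial>PiM I M)"
  proof (rule Bochner_Integration.integral_cong[OF refl])
    fix x assume "x \<in> space (PiM I M)"
    then have "x \<in> extensional I" by (auto simp: space_PiM PiE_def)
    then have "(restrict x J)(i := y) = x(i := y)" for y
      using J by (auto simp: fun_eq_iff restrict_def extensional_def J_def)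
    then show "h (restrict x J) = h x" unfolding h_def by simp
  qed
  finally show ?thesis unfolding h_def .
qed

primrec tube_walk :: "real \<Rightarrow> real \<Rightarrow> (nat \<Rightarrow> real) \<Rightarrow> nat \<Rightarrow> real" where
  "tube_walk H a z 0 = a"
| "tube_walk H a z (Suc j) = tube_step H (tube_walk H a z j) (z j)"

lemma abs_tube_walk_le:
  assumes "0 \<le> H" "\<bar>a\<bar> \<le> H"
  shows "\<bar>tube_walk H a z j\<bar> \<le> H"
  using assms by (cases j) (auto intro: abs_tube_step_le)

lemma tube_walk_cong:
  assumes "\<And>l. l < j \<Longrightarrow> z l = z' l"
  shows "tube_walk H a z j = tube_walk H a z' j"
  using assms by (induction j) auto

definition walk_residual :: "real \<Rightarrow> real \<Rightarrow> (nat \<Rightarrow> real) \<Rightarrow> nat \<Rightarrow> real" where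
  "walk_residual H a z j = tube_walk H a z (Suc j) - tube_walk H a z j - z j"

lemma abs_walk_residual_le:
  assumes "0 \<le> H" "\<bar>a\<bar> \<le> H"
  shows "\<bar>walk_residual H a z j\<bar> \<le> 1 + 2 * \<bar>z j\<bar>"
  using abs_tube_step_diff[OF abs_tube_walk_le[OF assms], of z j "z j"]
  unfolding walk_residual_def by simp

lemma measurable_tube_walk:
  assumes "\<And>l. l < j \<Longrightarrow> (\<lambda>u. z u l) \<in> borel_measurable M"
  shows "(\<lambda>u. tube_walk H a (z u) j) \<in> borel_measurable M"
  using assms
proof (induction j)
  case (Suc j)
  have [measurable]: "(\<lambda>u. tube_walk H a (z u) j) \<in> borel_measurable M" using Suc by auto
  have [measurable]: "(\<lambda>u. z u j) \<in> borel_measurable M" using Suc.prems by auto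
  show ?case by (simp add: tube_step_def clip_def push_def wall_def)
qed simp

text \<open>Summing the one-step bound, the gains of the Lyapunov function telescope, and its range
  has length at most \<open>ln (1 + H)\<close>. The injection \<open>\<iota>\<close> says in which order the walk reads the
  coordinates: it is used both from left to right and from right to left.\<close>

lemma walk_energy_expectation:
  fixes M :: "'i \<Rightarrow> real measure" and \<iota> :: "nat \<Rightarrow> 'i" and X :: "nat \<Rightarrow> real \<Rightarrow> real"
  assumes prob: "\<And>i. prob_space (M i)" and I: "finite I"
    and inj: "inj_on \<iota> {..<N}" and \<iota>: "\<And>j. j < N \<Longrightarrow> \<iota> j \<in> I"
    and X: "\<And>j. j < N \<Longrightarrow> standard_gaussian_moments (M (\<iota> j)) (X j)"
    and H: "1 \<le> H" and a: "\<bar>a\<bar> \<le> H"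
  defines "z \<equiv> \<lambda>u j. X j (u (\<iota> j))"
  shows "\<And>j. j < N \<Longrightarrow> integrable (PiM I M) (\<lambda>u. (walk_residual H a (z u) j)\<^sup>2)"
    and "(\<Sum>j<N. \<integral>u. (walk_residual H a (z u) j)\<^sup>2 \<partial>PiM I M)
      \<le> energy_const * ln (1 + H) + 1800 * energy_const * real N / H\<^sup>2"
proof -
  interpret product_prob_space M I
    by (intro product_prob_spaceI prob)
  have H0: "0 \<le> H" using H by simp
  have Xm: "X j \<in> borel_measurable (M (\<iota> j))" if "j < N" for j
    using X[OF that] unfolding standard_gaussian_moments_def by auto
  have zm: "(\<lambda>u. z u j) \<in> borel_measurable (PiM I M)" if "j < N" for j
    unfolding z_def using Xm[OF that] \<iota>[OF that] by measurable
  have wm: "(\<lambda>u. tube_walk H a (z u) j) \<in> borel_measurable (PiM I M)" if "j \<le> N" for j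
    using zm that by (intro measurable_tube_walk) auto
  have zsq: "integrable (PiM I M) (\<lambda>u. (z u j)\<^sup>2)" if "j < N" for j
  proof -
    have "integrable (distr (PiM I M) (M (\<iota> j)) (\<lambda>u. u (\<iota> j))) (\<lambda>y. (X j y)\<^sup>2)"
      using X[OF that] PiM_component[OF \<iota>[OF that]] unfolding standard_gaussian_moments_def
      by (auto intro: integrable.intros)
    then show ?thesis unfolding z_def
      using \<iota>[OF that] Xm[OF that] by (subst (asm) integrable_distr_eq) auto
  qed
  have rm: "(\<lambda>u. walk_residual H a (z u) j) \<in> borel_measurable (PiM I M)" if "j < N" for j
    unfolding walk_residual_def using wm[of j] wm[of "Suc j"] zm[OF that] that by auto
  show ri: "integrable (PiM I M) (\<lambda>u. (walk_residual H a (z u) j)\<^sup>2)" if j: "j < N" for j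
  proof (rule Bochner_Integration.integrable_bound[where f="\<lambda>u. 2 + 8 * (z u j)\<^sup>2"])
    show "integrable (PiM I M) (\<lambda>u. 2 + 8 * (z u j)\<^sup>2)" using zsq[OF j] by auto
    have "(walk_residual H a (z u) j)\<^sup>2 \<le> 2 + 8 * (z u j)\<^sup>2" for u
    proof -
      have "(walk_residual H a (z u) j)\<^sup>2 \<le> (1 + 2 * \<bar>z u j\<bar>)\<^sup>2"
        using abs_walk_residual_le[OF H0 a, of "z u" j] by (intro abs_le_square_iff[THEN iffD1]) auto
      also have "\<dots> \<le> 2 + 8 * (z u j)\<^sup>2"
        using sum_squares_ge_zero[of "1 - 2 * \<bar>z u j\<bar>" 0] by (simp add: power2_eq_square algebra_simps)
      finally show ?thesis .
    qed
    then show "AE u in PiM I M. norm ((walk_residual H a (z u) j)\<^sup>2) \<le> norm (2 + 8 * (z u j)\<^sup>2)"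
      by (auto intro!: AE_I2 order_trans[OF _ abs_ge_self])
  qed (use rm[OF j] in auto)
  define L where "L = (\<lambda>j u. ln (wall H (tube_walk H a (z u) j)))"
  have wall1: "1 \<le> wall H (tube_walk H a u j)" for u j
    using wall_ge[OF abs_tube_walk_le[OF H0 a, of u j]] H by linarith
  have Lint: "integrable (PiM I M) (L j)" if "j \<le> N" for j
  proof (rule integrable_const_bound[where B="ln ((H + 200)\<^sup>2)"])
    have "\<bar>L j u\<bar> \<le> ln ((H + 200)\<^sup>2)" for u
    proof -
      have "L j u \<le> ln ((H + 200)\<^sup>2)" unfolding L_def
        using wall1[of "z u" j] wall_le[of H] by (intro ln_mono) auto
      moreover have "0 \<le> L j u" unfolding L_def using wall1[of "z u" j] by simp
      ultimately show ?thesis by simp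
    qed
    then show "AE u in PiM I M. norm (L j u) \<le> ln ((H + 200)\<^sup>2)" by auto
    show "L j \<in> borel_measurable (PiM I M)" unfolding L_def wall_def using wm[OF that] by measurable
  qed
  have one_step: "(\<integral>u. (walk_residual H a (z u) j)\<^sup>2 \<partial>PiM I M)
      \<le> energy_const * (integral\<^sup>L (PiM I M) (L (Suc j)) - integral\<^sup>L (PiM I M) (L j)) + 1800 * energy_const / H\<^sup>2"
    if j: "j < N" for j
  proof -
    \<comment> \<open>the slack of the one-step bound: its average over coordinate j alone is nonnegative\<close>
    define f where "f = (\<lambda>u. energy_const * (L (Suc j) u - L j u) + 1800 * energy_const / H\<^sup>2
         - (walk_residual H a (z u) j)\<^sup>2)"
    have fi: "integrable (PiM I M) f"
      unfolding f_def using Lint[of "Suc j"] Lint[of j] ri[OF j] j by auto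
    have "0 \<le> (\<integral>y. f (u(\<iota> j := y)) \<partial>M (\<iota> j))" for u
    proof -
      define x where "x = tube_walk H a (z u) j"
      have x: "\<bar>x\<bar> \<le> H" unfolding x_def by (rule abs_tube_walk_le[OF H0 a])
      \<comment> \<open>the position before step j does not read the coordinate of step j\<close>
      have wx: "tube_walk H a (z (u(\<iota> j := y))) j = x" for y
        unfolding x_def z_def
        by (rule tube_walk_cong) (use inj j in \<open>auto simp: inj_on_def\<close>)
      have zx: "z (u(\<iota> j := y)) j = X j y" for y unfolding z_def by simp
      have feq: "f (u(\<iota> j := y)) = energy_const * (ln (wall H (tube_step H x (X j y))) - ln (wall H x))
          + 1800 * energy_const / H\<^sup>2 - (tube_step H x (X j y) - x - X j y)\<^sup>2" for y
        unfolding f_def L_def walk_residual_def by (simp add: wx zx)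
      have [measurable]: "X j \<in> borel_measurable (M (\<iota> j))" by (rule Xm[OF j])
      have li: "integrable (M (\<iota> j)) (\<lambda>y. ln (wall H (tube_step H x (X j y))))"
      proof (rule finite_measure.integrable_const_bound[OF prob_space.finite_measure[OF prob], where B="ln ((H + 200)\<^sup>2)"])
        have "\<bar>ln (wall H (tube_step H x y))\<bar> \<le> ln ((H + 200)\<^sup>2)" for y
        proof -
          have w: "1 \<le> wall H (tube_step H x y)"
            using wall_ge[OF abs_tube_step_le[OF H0, of x y]] H by linarith
          have "ln (wall H (tube_step H x y)) \<le> ln ((H + 200)\<^sup>2)"
            using w wall_le[of H] by (intro ln_mono) auto
          then show ?thesis using w by simp
        qed
        then show "AE y in M (\<iota> j). norm (ln (wall H (tube_step H x (X j y)))) \<le> ln ((H + 200)\<^sup>2)"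
          by auto
      qed (simp add: wall_def tube_step_def clip_def)
      have "(\<integral>y. f (u(\<iota> j := y)) \<partial>M (\<iota> j)) = energy_const * ((\<integral>y. ln (wall H (tube_step H x (X j y))) \<partial>M (\<iota> j)) - ln (wall H x))
         + 1800 * energy_const / H\<^sup>2 - (\<integral>y. (tube_step H x (X j y) - x - X j y)\<^sup>2 \<partial>M (\<iota> j))"
        unfolding feq using li tube_step_energy(1)[OF X[OF j] H x] by (simp add: prob_space.prob_space[OF prob])
      then show ?thesis using tube_step_energy(2)[OF X[OF j] H x] by linarith
    qed
    then have "0 \<le> integral\<^sup>L (PiM I M) f"
      unfolding integral_resample[OF I \<iota>[OF j] fi] by (intro integral_nonneg_AE) auto
    then show ?thesis unfolding f_def using Lint[of "Suc j"] Lint[of j] ri[OF j] j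
      by (simp add: P.prob_space)
  qed
  have "(\<Sum>j<N. \<integral>u. (walk_residual H a (z u) j)\<^sup>2 \<partial>PiM I M)
     \<le> (\<Sum>j<N. energy_const * (integral\<^sup>L (PiM I M) (L (Suc j)) - integral\<^sup>L (PiM I M) (L j)) + 1800 * energy_const / H\<^sup>2)"
    using one_step by (intro sum_mono) auto
  also have "\<dots> = energy_const * (integral\<^sup>L (PiM I M) (L N) - integral\<^sup>L (PiM I M) (L 0)) + 1800 * energy_const * real N / H\<^sup>2"
    using sum_lessThan_telescope[of "\<lambda>j. integral\<^sup>L (PiM I M) (L j)" N]
    by (simp add: sum.distrib sum_distrib_left[symmetric])
  also have "\<dots> \<le> energy_const * ln (1 + H) + 1800 * energy_const * real N / H\<^sup>2"
  proof -
    have "L N u - L 0 u \<le> ln (1 + H)" for u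
    proof -
      define w0 where "w0 = wall H (tube_walk H a (z u) 0)"
      have "400 * H + 40000 \<le> w0" unfolding w0_def by (rule wall_ge[OF abs_tube_walk_le[OF H0 a]])
      then have "400 * H + 40000 \<le> w0" "(1 + H) * (400 * H + 40000) \<le> (1 + H) * w0" using H by (auto intro!: mult_left_mono)
      moreover have "(1 + H) * (400 * H + 40000) - (H + 200)\<^sup>2 = H * (399 * H + 40000)"
        by (simp add: power2_eq_square algebra_simps)
      moreover have "0 \<le> H * (399 * H + 40000)" using H0 by simp
      ultimately have "(H + 200)\<^sup>2 \<le> (1 + H) * w0" by linarith
      then have "wall H (tube_walk H a (z u) N) \<le> (1 + H) * w0" using wall_le order_trans by blast
      then have "L N u \<le> ln ((1 + H) * w0)" unfolding L_def
        using wall1[of "z u" N] by (intro ln_mono) auto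
      also have "\<dots> = ln (1 + H) + L 0 u"
        using wall1[of "z u" 0] H unfolding L_def w0_def by (simp add: ln_mult)
      finally show ?thesis by simp
    qed
    then have "integral\<^sup>L (PiM I M) (\<lambda>u. L N u - L 0 u) \<le> integral\<^sup>L (PiM I M) (\<lambda>u. ln (1 + H))"
      using Lint[of N] Lint[of 0] by (intro integral_mono) auto
    then have "integral\<^sup>L (PiM I M) (L N) - integral\<^sup>L (PiM I M) (L 0) \<le> ln (1 + H)"
      using Lint[of N] Lint[of 0] by (simp add: P.prob_space)
    then have "energy_const * (integral\<^sup>L (PiM I M) (L N) - integral\<^sup>L (PiM I M) (L 0)) \<le> energy_const * ln (1 + H)"
      by (intro mult_left_mono) (auto simp: energy_const_def)
    then show ?thesis by simp
  qed
  finally show "(\<Sum>j<N. \<integral>u. (walk_residual H a (z u) j)\<^sup>2 \<partial>PiM I M)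
      \<le> energy_const * ln (1 + H) + 1800 * energy_const * real N / H\<^sup>2" .
qed

section \<open>Constant pieces and dual paths\<close>

lemma finite_jumps: "finite (jumps n \<theta>)"
  unfolding jumps_def by auto

lemma jump_index_0: "jump_index n \<theta> 0 = 1"
  unfolding jump_index_def by simp

lemma jump_index_last: "jump_index n \<theta> (num_jumps n \<theta> + 1) = n + 1"
  unfolding jump_index_def by simp

lemma jump_index_in_jumps:
  assumes "1 \<le> i" "i \<le> num_jumps n \<theta>"
  shows "jump_index n \<theta> i \<in> jumps n \<theta>"
proof -
  have "i - 1 < length (sorted_list_of_set (jumps n \<theta>))"
    using assms unfolding num_jumps_def by simp
  then have "sorted_list_of_set (jumps n \<theta>) ! (i - 1) \<in> set (sorted_list_of_set (jumps n \<theta>))"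
    by (rule nth_mem)
  then show ?thesis using assms finite_jumps unfolding jump_index_def by simp
qed

lemma jump_index_surj:
  assumes "j \<in> jumps n \<theta>"
  obtains i where "1 \<le> i" "i \<le> num_jumps n \<theta>" "jump_index n \<theta> i = j"
proof -
  have "j \<in> set (sorted_list_of_set (jumps n \<theta>))" using assms finite_jumps by simp
  then obtain i where i: "i < num_jumps n \<theta>" "sorted_list_of_set (jumps n \<theta>) ! i = j"
    unfolding in_set_conv_nth num_jumps_def by auto
  show ?thesis by (rule that[of "i + 1"]) (use i in \<open>auto simp: jump_index_def\<close>)
qed

lemma jump_index_less_Suc:
  assumes n: "1 \<le> n" and i: "i \<le> num_jumps n \<theta>"
  shows "jump_index n \<theta> i < jump_index n \<theta> (i + 1)"
proof -
  have range: "2 \<le> jump_index n \<theta> p" "jump_index n \<theta> p \<le> n" if "1 \<le> p" "p \<le> num_jumps n \<theta>" for p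
    using jump_index_in_jumps[OF that] unfolding jumps_def by auto
  consider "i = 0" "num_jumps n \<theta> = 0" | "i = 0" "1 \<le> num_jumps n \<theta>" | "1 \<le> i" "i < num_jumps n \<theta>"
    | "1 \<le> i" "i = num_jumps n \<theta>"
    using i by linarith
  then show ?thesis
  proof cases
    case 1
    then show ?thesis using n unfolding jump_index_def by simp
  next
    case 2
    then show ?thesis using range[of 1] jump_index_0[of n \<theta>] by simp
  next
    case 3
    have "sorted_list_of_set (jumps n \<theta>) ! (i - 1) < sorted_list_of_set (jumps n \<theta>) ! i"
      using 3 finite_jumps[of n \<theta>]
      by (intro sorted_wrt_nth_less[of "(<)"]) (auto simp: num_jumps_def)
    then show ?thesis using 3 unfolding jump_index_def by auto
  next
    case 4
    then show ?thesis using range[of i] jump_index_last[of n \<theta>] by simp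
  qed
qed

lemma jump_index_mono:
  assumes n: "1 \<le> n" and "p \<le> q" "q \<le> num_jumps n \<theta> + 1"
  shows "jump_index n \<theta> p \<le> jump_index n \<theta> q"
  using assms(2,3)
proof (induction q rule: dec_induct)
  case (step q)
  then show ?case using jump_index_less_Suc[OF n, of q \<theta>] by simp
qed simp

lemma piece_length_pos:
  assumes "1 \<le> n" "p \<le> num_jumps n \<theta>"
  shows "1 \<le> piece_length n \<theta> p"
  using jump_index_less_Suc[OF assms] unfolding piece_length_def by simp

lemma jump_index_Suc:
  assumes "1 \<le> n" "p \<le> num_jumps n \<theta>"
  shows "jump_index n \<theta> (p + 1) = jump_index n \<theta> p + piece_length n \<theta> p"
  using jump_index_less_Suc[OF assms] unfolding piece_length_def by simp

lemma sum_pieces: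
  assumes n: "1 \<le> n"
  shows "(\<Sum>i=1..n. f i) = (\<Sum>p\<le>num_jumps n \<theta>. \<Sum>j<piece_length n \<theta> p. f (jump_index n \<theta> p + j))"
proof -
  have "(\<Sum>i=jump_index n \<theta> 0..<jump_index n \<theta> m. f i)
      = (\<Sum>p<m. \<Sum>j<piece_length n \<theta> p. f (jump_index n \<theta> p + j))" if "m \<le> num_jumps n \<theta> + 1" for m
    using that
  proof (induction m)
    case (Suc m)
    have m: "m \<le> num_jumps n \<theta>" using Suc.prems by simp
    have "(\<Sum>i=jump_index n \<theta> 0..<jump_index n \<theta> (Suc m). f i)
        = (\<Sum>i=jump_index n \<theta> 0..<jump_index n \<theta> m. f i) + (\<Sum>i=jump_index n \<theta> m..<jump_index n \<theta> (Suc m). f i)"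
      using jump_index_mono[OF n, of 0 m \<theta>] jump_index_mono[OF n, of m "Suc m" \<theta>] m
      by (intro sum.atLeastLessThan_concat[symmetric]) auto
    moreover have "(\<Sum>i=jump_index n \<theta> m..<jump_index n \<theta> (Suc m). f i) = (\<Sum>j<piece_length n \<theta> m. f (jump_index n \<theta> m + j))"
      using jump_index_Suc[OF n m] sum.shift_bounds_nat_ivl[of f 0 "jump_index n \<theta> m" "piece_length n \<theta> m"]
      by (simp add: lessThan_atLeast0 add.commute)
    ultimately show ?case using Suc by simp
  qed simp
  from this[of "num_jumps n \<theta> + 1"] show ?thesis
    unfolding jump_index_last jump_index_0 by (simp add: lessThan_Suc_atMost atLeastLessThanSuc_atLeastAtMost)
qed

lemma sum_piece_length:
  assumes "1 \<le> n"
  shows "(\<Sum>p\<le>num_jumps n \<theta>. piece_length n \<theta> p) = n"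
  using sum_pieces[OF assms, of "\<lambda>_. 1 :: nat" \<theta>] by simp

lemma num_jumps_less:
  assumes "1 \<le> n"
  shows "num_jumps n \<theta> + 1 \<le> n"
proof -
  have "(\<Sum>p\<le>num_jumps n \<theta>. 1) \<le> (\<Sum>p\<le>num_jumps n \<theta>. piece_length n \<theta> p)"
    using piece_length_pos[OF assms] by (intro sum_mono) auto
  then show ?thesis using sum_piece_length[OF assms, of \<theta>] by simp
qed

lemma abs_jump_sign_le: "\<bar>real_of_int (jump_sign n \<theta> p)\<bar> \<le> 1"
  unfolding jump_sign_def by auto

text \<open>The dual path can be chosen on each constant piece separately, as long as it starts and ends at \<open>l\<close>
  times the signs of the adjacent jumps. The edges of a piece are numbered from \<open>0\<close>, the jump that opens
  it, to its length.\<close>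

lemma squared_error_le_pieces:
  fixes W :: "nat \<Rightarrow> nat \<Rightarrow> real" and l :: real
  assumes n: "1 \<le> n" and \<sigma>: "0 < \<sigma>" and l: "0 \<le> l" and \<theta>: "\<theta> \<in> Rn n"
    and W0: "\<And>p. p \<le> num_jumps n \<theta> \<Longrightarrow> W p 0 = l * jump_sign n \<theta> p"
    and WN: "\<And>p. p \<le> num_jumps n \<theta> \<Longrightarrow> W p (piece_length n \<theta> p) = l * jump_sign n \<theta> (p + 1)"
    and Wl: "\<And>p j. p \<le> num_jumps n \<theta> \<Longrightarrow> j \<le> piece_length n \<theta> p \<Longrightarrow> \<bar>W p j\<bar> \<le> l"
  shows "squared_error n (penalized_estimator n \<sigma> l) \<theta> Y \<le> (\<Sum>p\<le>num_jumps n \<theta>. \<Sum>j<piece_length n \<theta> p.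
      (Y (jump_index n \<theta> p + j) - \<theta> (jump_index n \<theta> p + j) - \<sigma> * (W p j - W p (j + 1)))\<^sup>2)"
proof -
  let ?k = "num_jumps n \<theta>" and ?J = "jump_index n \<theta>" and ?N = "piece_length n \<theta>"
  \<comment> \<open>the number of the piece that contains index i\<close>
  define pc where "pc = (\<lambda>i. LEAST p. i < ?J (p + 1))"
  define U where "U = (\<lambda>e. if e < n then W (pc (e + 1)) (e + 1 - ?J (pc (e + 1))) else 0)"
  have pc: "pc (?J p + j) = p" if p: "p \<le> ?k" and j: "j < ?N p" for p j
    unfolding pc_def
  proof (rule Least_equality)
    show "?J p + j < ?J (p + 1)" using jump_index_Suc[OF n p] j by simp
    fix q assume q: "?J p + j < ?J (q + 1)"
    show "p \<le> q"
    proof (rule ccontr)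
      assume "\<not> p \<le> q"
      then have "?J (q + 1) \<le> ?J p" using p by (intro jump_index_mono[OF n]) auto
      then show False using q by simp
    qed
  qed
  have le_n: "?J p + j \<le> n" if p: "p \<le> ?k" and j: "j < ?N p" for p j
    using jump_index_Suc[OF n p] jump_index_mono[OF n, of "p + 1" "?k + 1" \<theta>] p j jump_index_last[of n \<theta>] by simp
  have J1: "1 \<le> ?J p" if "p \<le> ?k" for p
    using jump_index_mono[OF n, of 0 p \<theta>] that jump_index_0[of n \<theta>] by simp
  have U_left: "U (?J p + j - 1) = W p j" if p: "p \<le> ?k" and j: "j < ?N p" for p j
  proof -
    have "?J p + j - 1 + 1 = ?J p + j" using J1[OF p] by simp
    then show ?thesis unfolding U_def using pc[OF p j] le_n[OF p j] J1[OF p] by simp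
  qed
  have U_right: "U (?J p + j) = W p (j + 1)" if p: "p \<le> ?k" and j: "j < ?N p" for p j
  proof (cases "j + 1 < ?N p")
    case True
    then show ?thesis using U_left[OF p True] by simp
  next
    case False
    then have jN: "j + 1 = ?N p" using j by simp
    then have Jj: "?J p + j + 1 = ?J (p + 1)" using jump_index_Suc[OF n p] by simp
    show ?thesis
    proof (cases "p = ?k")
      case True
      then have "?J p + j = n" using Jj jump_index_last[of n \<theta>] by simp
      moreover have "W p (j + 1) = 0" using WN[OF p] jN True by (simp add: jump_sign_def)
      ultimately show ?thesis unfolding U_def by simp
    next
      case False
      then have p': "p + 1 \<le> ?k" using p by simp
      have "U (?J (p + 1) + 0 - 1) = W (p + 1) 0"
        using piece_length_pos[OF n p'] by (intro U_left[OF p']) auto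
      then have "U (?J p + j) = W (p + 1) 0" using Jj by (metis add_diff_cancel_right' add_0_right)
      then show ?thesis using W0[OF p'] WN[OF p] jN by simp
    qed
  qed
  have "squared_error n (penalized_estimator n \<sigma> l) \<theta> Y \<le> (\<Sum>i=1..n. (Y i - \<theta> i - \<sigma> * (U (i - 1) - U i))\<^sup>2)"
  proof (rule squared_error_le_dual)
    show "1 \<le> n" "0 < \<sigma>" "0 \<le> l" "\<theta> \<in> Rn n" by fact+
    show "U 0 = 0"
      using U_left[of 0 0] piece_length_pos[OF n, of 0 \<theta>] W0[of 0] jump_index_0[of n \<theta>] by (simp add: jump_sign_def)
    show "U n = 0" unfolding U_def by simp
  next
    fix e assume e: "e \<in> {1..n-1}"
    define p where "p = pc (e + 1)"
    have "e < n" using e n unfolding atLeastAtMost_iff by linarith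
    then have "e + 1 < ?J (?k + 1)" unfolding jump_index_last by simp
    then have p2: "e + 1 < ?J (p + 1)" and pk: "p \<le> ?k"
      unfolding p_def pc_def by (auto intro: LeastI Least_le)
    have p1: "?J p \<le> e + 1"
    proof (cases p)
      case 0
      then show ?thesis by (simp add: jump_index_0)
    next
      case (Suc q)
      then have "\<not> e + 1 < ?J (q + 1)" using not_less_Least[of q "\<lambda>p. e + 1 < ?J (p + 1)"] unfolding p_def pc_def by auto
      then show ?thesis using Suc by simp
    qed
    then have "e + 1 - ?J p \<le> ?N p" using p2 jump_index_Suc[OF n pk] by simp
    then show "\<bar>U e\<bar> \<le> l" using Wl[OF pk] l unfolding U_def p_def by simp
  next
    fix e assume e: "e \<in> {1..n-1}" and ne: "\<theta> e \<noteq> \<theta> (e + 1)"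
    then have "e + 1 \<in> jumps n \<theta>" unfolding jumps_def by auto
    then obtain p where p: "1 \<le> p" "p \<le> ?k" "?J p = e + 1" by (rule jump_index_surj)
    have "U e = W p 0" using U_left[OF p(2), of 0] piece_length_pos[OF n p(2)] p(3) by simp
    then show "U e = l * sgn (\<theta> (e + 1) - \<theta> e)"
      using W0[OF p(2)] p ne unfolding jump_sign_def by auto
  qed
  also have "\<dots> = (\<Sum>p\<le>?k. \<Sum>j<?N p. (Y (?J p + j) - \<theta> (?J p + j) - \<sigma> * (U (?J p + j - 1) - U (?J p + j)))\<^sup>2)"
    by (rule sum_pieces[OF n])
  also have "\<dots> = (\<Sum>p\<le>?k. \<Sum>j<?N p. (Y (?J p + j) - \<theta> (?J p + j) - \<sigma> * (W p j - W p (j + 1)))\<^sup>2)"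
    using U_left U_right by (intro sum.cong refl) auto
  finally show ?thesis .
qed

lemma power2_add_le: "(u + v)\<^sup>2 \<le> 2 * u\<^sup>2 + 2 * v\<^sup>2" for u v :: real
  using sum_squares_ge_zero[of "u - v" 0] by (simp add: power2_eq_square algebra_simps)

text \<open>A walk from each end of the piece has the right value at that end only. The average of the two with
  weights that change linearly along the piece has the right values at both ends. It stays within the bound
  because that constraint is convex, and its residual is the average of the residuals up to the gap between
  the walks divided by \<open>N\<close>. The parameters \<open>mL\<close>, \<open>mR\<close> are the centres of the tubes of the two walks.\<close>

lemma exists_bridge:
  fixes z :: "nat \<Rightarrow> real"
  assumes N: "1 \<le> N" and H: "0 \<le> H" and a: "\<bar>a\<bar> \<le> H" and b: "\<bar>b\<bar> \<le> H"
    and mL: "\<bar>mL\<bar> + H \<le> l" and mR: "\<bar>mR\<bar> + H \<le> l" and G: "\<bar>mL - mR\<bar> + 2 * H \<le> G"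
  shows "\<exists>W. W 0 = mL + a \<and> W N = mR + b \<and> (\<forall>j\<le>N. \<bar>W j\<bar> \<le> l) \<and>
    (\<Sum>j<N. (z j - (W j - W (j + 1)))\<^sup>2)
      \<le> 2 * (\<Sum>j<N. (walk_residual H a (\<lambda>i. - z i) j)\<^sup>2)
        + 2 * (\<Sum>j<N. (walk_residual H b (\<lambda>i. z (N - 1 - i)) j)\<^sup>2) + 2 * G\<^sup>2 / real N"
proof -
  define L where "L = (\<lambda>j. mL + tube_walk H a (\<lambda>i. - z i) j)"
  define R where "R = (\<lambda>j. mR + tube_walk H b (\<lambda>i. z (N - 1 - i)) (N - j))"
  define W where "W = (\<lambda>j. (1 - real j / real N) * L j + (real j / real N) * R j)"
  define rL where "rL = walk_residual H a (\<lambda>i. - z i)"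
  define rR where "rR = walk_residual H b (\<lambda>i. z (N - 1 - i))"
  have tb: "\<bar>tube_walk H a u j\<bar> \<le> H" "\<bar>tube_walk H b u j\<bar> \<le> H" for u j
    using abs_tube_walk_le[OF H a] abs_tube_walk_le[OF H b] by auto
  have Ll: "\<bar>L j\<bar> \<le> l" for j unfolding L_def using tb(1)[of "\<lambda>i. - z i" j] mL by linarith
  have Rl: "\<bar>R j\<bar> \<le> l" for j unfolding R_def using tb(2)[of "\<lambda>i. z (N - 1 - i)" "N - j"] mR by linarith
  have RL: "\<bar>R j - L j\<bar> \<le> G" for j unfolding R_def L_def
    using tb(1)[of "\<lambda>i. - z i" j] tb(2)[of "\<lambda>i. z (N - 1 - i)" "N - j"] G by linarith
  have N0: "0 < real N" using N by simp
  have "\<bar>W j\<bar> \<le> l" if j: "j \<le> N" for j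
  proof -
    have t: "0 \<le> real j / real N" "real j / real N \<le> 1" using j N by auto
    have "\<bar>W j\<bar> \<le> (1 - real j / real N) * \<bar>L j\<bar> + (real j / real N) * \<bar>R j\<bar>"
      unfolding W_def using t abs_triangle_ineq[of "(1 - real j / real N) * L j" "(real j / real N) * R j"] by (simp add: abs_mult)
    also have "\<dots> \<le> (1 - real j / real N) * l + (real j / real N) * l"
      using t Ll Rl by (intro add_mono mult_left_mono) auto
    finally show ?thesis by (simp add: algebra_simps)
  qed
  moreover have "W 0 = mL + a" unfolding W_def L_def by simp
  moreover have "W N = mR + b" unfolding W_def R_def using N by simp
  moreover have "(\<Sum>j<N. (z j - (W j - W (j + 1)))\<^sup>2) \<le> (\<Sum>j<N. 2 * (rL j)\<^sup>2 + 2 * (rR (N - Suc j))\<^sup>2 + 2 * G\<^sup>2 / (real N)\<^sup>2)"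
  proof (rule sum_mono)
    fix j assume "j \<in> {..<N}"
    then have j: "j < N" by simp
    define t where "t = real (j + 1) / real N"
    have t: "0 \<le> t" "t \<le> 1" unfolding t_def using j by auto
    have L1: "L (j + 1) - L j + z j = rL j" unfolding L_def rL_def walk_residual_def by simp
    have R1: "R (j + 1) - R j + z j = - rR (N - Suc j)"
    proof -
      have "N - j = Suc (N - Suc j)" "N - 1 - (N - Suc j) = j" using j by auto
      then show ?thesis unfolding R_def rR_def walk_residual_def by simp
    qed
    have "real j / real N = t - 1 / real N" unfolding t_def using N0 by (simp add: field_simps)
    then have "W j = (1 - (t - 1 / real N)) * L j + (t - 1 / real N) * R j" unfolding W_def by simp
    then have "W j = (1 - t) * L j + t * R j + (L j - R j) / real N"
      by (simp add: algebra_simps diff_divide_distrib)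
    moreover have "W (j + 1) = (1 - t) * L (j + 1) + t * R (j + 1)" unfolding W_def t_def by simp
    ultimately have "z j - (W j - W (j + 1)) = ((1 - t) * (L (j + 1) - L j + z j) + t * (R (j + 1) - R j + z j)) + (R j - L j) / real N"
      by (simp add: algebra_simps diff_divide_distrib)
    then have "(z j - (W j - W (j + 1)))\<^sup>2 = (((1 - t) * rL j - t * rR (N - Suc j)) + (R j - L j) / real N)\<^sup>2"
      unfolding L1 R1 by simp
    also have "\<dots> \<le> 2 * ((1 - t) * rL j - t * rR (N - Suc j))\<^sup>2 + 2 * ((R j - L j) / real N)\<^sup>2"
      by (rule power2_add_le)
    also have "((1 - t) * rL j - t * rR (N - Suc j))\<^sup>2 \<le> (rL j)\<^sup>2 + (rR (N - Suc j))\<^sup>2"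
    proof -
      have "(1 - t) * (rL j)\<^sup>2 + t * (rR (N - Suc j))\<^sup>2 - ((1 - t) * rL j - t * rR (N - Suc j))\<^sup>2
          = t * (1 - t) * (rL j + rR (N - Suc j))\<^sup>2" by (simp add: power2_eq_square algebra_simps)
      moreover have "0 \<le> t * (1 - t) * (rL j + rR (N - Suc j))\<^sup>2" using t by simp
      moreover have "(1 - t) * (rL j)\<^sup>2 \<le> 1 * (rL j)\<^sup>2" "t * (rR (N - Suc j))\<^sup>2 \<le> 1 * (rR (N - Suc j))\<^sup>2"
        using t by (intro mult_right_mono; simp)+
      ultimately show ?thesis by linarith
    qed
    also have "((R j - L j) / real N)\<^sup>2 \<le> G\<^sup>2 / (real N)\<^sup>2"
    proof -
      have "(R j - L j)\<^sup>2 \<le> G\<^sup>2" using RL[of j] by (intro abs_le_square_iff[THEN iffD1]) linarith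
      then show ?thesis by (simp add: power_divide divide_right_mono)
    qed
    finally show "(z j - (W j - W (j + 1)))\<^sup>2 \<le> 2 * (rL j)\<^sup>2 + 2 * (rR (N - Suc j))\<^sup>2 + 2 * G\<^sup>2 / (real N)\<^sup>2"
      by simp
  qed
  moreover have "(\<Sum>j<N. 2 * (rL j)\<^sup>2 + 2 * (rR (N - Suc j))\<^sup>2 + 2 * G\<^sup>2 / (real N)\<^sup>2)
     = 2 * (\<Sum>j<N. (rL j)\<^sup>2) + 2 * (\<Sum>j<N. (rR j)\<^sup>2) + 2 * G\<^sup>2 / real N"
    using N0 by (simp add: sum.distrib sum_distrib_left[symmetric] sum.nat_diff_reindex[of "\<lambda>j. (rR j)\<^sup>2"] power2_eq_square[of "real N"])
  ultimately show ?thesis unfolding rL_def rR_def by (intro exI[of _ W]) auto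
qed

section \<open>The expected error for a given penalty\<close>

text \<open>On each piece the tube has half-width \<open>H = min l (sqrt N)\<close> and contains \<open>l\<close> times the sign of the
  jump at which its walk starts, at one end if the sign is not \<open>0\<close>. If the signs at both
  ends of the piece agree, then both walks live in the same tube and the gap is at most \<open>2 H\<close>. If they differ, it may be as large as \<open>2 l\<close>. Only pieces in \<open>sign_changes\<close> pay
  for this.\<close>

lemma gaussian_expected_squared_error:
  assumes n: "1 \<le> n" and \<sigma>: "0 < \<sigma>" and l: "1 \<le> l" and \<theta>: "\<theta> \<in> Rn n"
  defines "k \<equiv> num_jumps n \<theta>" and "N \<equiv> piece_length n \<theta>"
  defines "H \<equiv> \<lambda>p. min l (sqrt (real (N p)))"
  defines "G \<equiv> \<lambda>p. if p \<in> sign_changes n \<theta> then 2 * l else 2 * H p"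
  shows "integrable (gaussian n \<theta> \<sigma>) (squared_error n (penalized_estimator n \<sigma> l) \<theta>)"
    and "(\<integral>Y. squared_error n (penalized_estimator n \<sigma> l) \<theta> Y \<partial>gaussian n \<theta> \<sigma>)
      \<le> \<sigma>\<^sup>2 * (\<Sum>p\<le>k. 4 * (energy_const * ln (1 + H p) + 1800 * energy_const * real (N p) / (H p)\<^sup>2)
             + 2 * (G p)\<^sup>2 / real (N p))"
proof -
  define M where "M = (\<lambda>i. density lborel (\<lambda>x. ennreal (normal_density (\<theta> i) \<sigma> x)))"
  have gM: "gaussian n \<theta> \<sigma> = PiM {1..n} M" unfolding gaussian_def M_def ..
  have pM: "prob_space (M i)" for i unfolding M_def by (rule prob_space_normal_density[OF \<sigma>])
  interpret product_prob_space M "{1..n}" by (intro product_prob_spaceI pM)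
  have setsM: "sets (PiM {1..n} M) = sets (PiM {1..n} (\<lambda>_. borel))"
    by (intro sets_PiM_cong) (auto simp: M_def)
  let ?J = "jump_index n \<theta>" and ?s = "\<lambda>p. real_of_int (jump_sign n \<theta> p)"
  define z where "z = (\<lambda>Y i. (Y i - \<theta> i) / \<sigma>)"
  define rL where "rL = (\<lambda>p j Y. walk_residual (H p) (?s p * H p) (\<lambda>i. - z Y (?J p + i)) j)"
  define rR where "rR = (\<lambda>p j Y. walk_residual (H p) (?s (p + 1) * H p) (\<lambda>i. z Y (?J p + (N p - 1 - i))) j)"
  define V where "V = (\<lambda>Y. \<sigma>\<^sup>2 * (\<Sum>p\<le>k. 2 * (\<Sum>j<N p. (rL p j Y)\<^sup>2) + 2 * (\<Sum>j<N p. (rR p j Y)\<^sup>2) + 2 * (G p)\<^sup>2 / real (N p)))"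
  have N1: "1 \<le> N p" if "p \<le> k" for p using piece_length_pos[OF n] that unfolding N_def k_def by simp
  have H1: "1 \<le> H p" if "p \<le> k" for p using N1[OF that] l unfolding H_def by simp
  have Hl: "H p \<le> l" for p unfolding H_def by simp
  have sH: "\<bar>?s q * H p\<bar> \<le> H p" if "p \<le> k" for p q
    using abs_jump_sign_le[of n \<theta> q] H1[OF that] by (simp add: abs_mult mult_left_le_one_le)
  have sl: "\<bar>?s q * (l - H p)\<bar> + H p \<le> l" for p q
    using abs_jump_sign_le[of n \<theta> q] Hl[of p] by (simp add: abs_mult) (metis diff_ge_0_iff_ge le_diff_eq mult_left_le_one_le abs_ge_zero)
  have dom: "squared_error n (penalized_estimator n \<sigma> l) \<theta> Y \<le> V Y" for Y
  proof -
    \<comment> \<open>a dual path on piece p with the residual that the bridge between two walks achieves\<close>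
    define good where "good = (\<lambda>p W. W 0 = l * ?s p \<and> W (N p) = l * ?s (p + 1) \<and> (\<forall>j\<le>N p. \<bar>W j\<bar> \<le> l) \<and>
       (\<Sum>j<N p. (z Y (?J p + j) - (W j - W (j + 1)))\<^sup>2)
      \<le> 2 * (\<Sum>j<N p. (rL p j Y)\<^sup>2) + 2 * (\<Sum>j<N p. (rR p j Y)\<^sup>2) + 2 * (G p)\<^sup>2 / real (N p))"
    have good_ex: "\<exists>W. good p W"
      if p: "p \<le> k" for p
    proof -
      have G: "\<bar>?s p * (l - H p) - ?s (p + 1) * (l - H p)\<bar> + 2 * H p \<le> G p"
      proof (cases "p \<in> sign_changes n \<theta>")
        case True
        have "\<bar>?s p * (l - H p) - ?s (p + 1) * (l - H p)\<bar> \<le> \<bar>?s p * (l - H p)\<bar> + \<bar>?s (p + 1) * (l - H p)\<bar>"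
          by (rule abs_triangle_ineq4)
        then show ?thesis using sl[of p p] sl[of "p + 1" p] True unfolding G_def by simp
      next
        case False
        then have "jump_sign n \<theta> p = jump_sign n \<theta> (p + 1)" using p unfolding sign_changes_def k_def by auto
        then show ?thesis using False unfolding G_def by simp
      qed
      have "?s p * (l - H p) + ?s p * H p = l * ?s p" "?s (p + 1) * (l - H p) + ?s (p + 1) * H p = l * ?s (p + 1)"
        by (simp_all add: algebra_simps)
      then show ?thesis
        using exists_bridge[OF N1[OF p] _ sH[OF p, of p] sH[OF p, of "p + 1"] sl[of p p] sl[of "p + 1" p] G, of "\<lambda>j. z Y (?J p + j)"]
          H1[OF p] unfolding good_def rL_def rR_def by simp
    qed
    define W where "W = (\<lambda>p. SOME W. good p W)"
    have "good p (W p)" if "p \<le> k" for p unfolding W_def using someI_ex[OF good_ex[OF that]] .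
    note W = this[unfolded good_def]
    have "squared_error n (penalized_estimator n \<sigma> l) \<theta> Y \<le> (\<Sum>p\<le>k. \<Sum>j<N p.
      (Y (?J p + j) - \<theta> (?J p + j) - \<sigma> * (W p j - W p (j + 1)))\<^sup>2)"
      unfolding k_def N_def
      by (rule squared_error_le_pieces[OF n \<sigma> _ \<theta>]) (use W l in \<open>auto simp: k_def N_def\<close>)
    also have "\<dots> = \<sigma>\<^sup>2 * (\<Sum>p\<le>k. \<Sum>j<N p. (z Y (?J p + j) - (W p j - W p (j + 1)))\<^sup>2)"
      unfolding sum_distrib_left
    proof (intro sum.cong refl)
      fix p j
      have "Y (?J p + j) - \<theta> (?J p + j) = \<sigma> * z Y (?J p + j)" unfolding z_def using \<sigma> by simp
      then show "(Y (?J p + j) - \<theta> (?J p + j) - \<sigma> * (W p j - W p (j + 1)))\<^sup>2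
         = \<sigma>\<^sup>2 * (z Y (?J p + j) - (W p j - W p (j + 1)))\<^sup>2"
        by (simp add: right_diff_distrib[symmetric] power_mult_distrib)
    qed
    also have "\<dots> \<le> V Y" unfolding V_def using W by (intro mult_left_mono sum_mono) auto
    finally show ?thesis .
  qed
  have in_n: "?J p + j \<in> {1..n}" if p: "p \<le> k" and j: "j < N p" for p j
    using jump_index_mono[OF n, of 0 p \<theta>] jump_index_mono[OF n, of "p + 1" "num_jumps n \<theta> + 1" \<theta>]
      jump_index_Suc[OF n, of p \<theta>] p j jump_index_0[of n \<theta>] jump_index_last[of n \<theta>]
    unfolding k_def N_def by auto
  have mom: "standard_gaussian_moments (M i) (\<lambda>y. c * ((y - \<theta> i) / \<sigma>))" if "c = 1 \<or> c = -1" for c i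
    unfolding M_def by (rule normal_standard_moments[OF \<sigma> that])
  have L: "(\<forall>j<N p. integrable (PiM {1..n} M) (\<lambda>Y. (rL p j Y)\<^sup>2)) \<and>
      (\<Sum>j<N p. \<integral>Y. (rL p j Y)\<^sup>2 \<partial>PiM {1..n} M) \<le> energy_const * ln (1 + H p) + 1800 * energy_const * real (N p) / (H p)\<^sup>2"
    if p: "p \<le> k" for p
  proof -
    have inj: "inj_on (\<lambda>j. ?J p + j) {..<N p}" by (auto simp: inj_on_def)
    have X: "standard_gaussian_moments (M i) (\<lambda>y. - ((y - \<theta> i) / \<sigma>))" for i
      using mom[of "-1" i] by (simp only: mult_minus1) simp
    note e = walk_energy_expectation[of M "{1..n}" "\<lambda>j. ?J p + j" "N p", OF pM _ inj in_n[OF p] X H1[OF p] sH[OF p, of p]]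
    show ?thesis
      unfolding rL_def z_def using e by auto
  qed
  have R: "(\<forall>j<N p. integrable (PiM {1..n} M) (\<lambda>Y. (rR p j Y)\<^sup>2)) \<and>
      (\<Sum>j<N p. \<integral>Y. (rR p j Y)\<^sup>2 \<partial>PiM {1..n} M) \<le> energy_const * ln (1 + H p) + 1800 * energy_const * real (N p) / (H p)\<^sup>2"
    if p: "p \<le> k" for p
  proof -
    have inj: "inj_on (\<lambda>j. ?J p + (N p - 1 - j)) {..<N p}" by (auto simp: inj_on_def)
    have \<iota>: "?J p + (N p - 1 - j) \<in> {1..n}" if "j < N p" for j using that by (intro in_n[OF p]) auto
    have X: "standard_gaussian_moments (M i) (\<lambda>y. (y - \<theta> i) / \<sigma>)" for i
      using mom[of 1 i] by simp
    note e = walk_energy_expectation[of M "{1..n}" "\<lambda>j. ?J p + (N p - 1 - j)" "N p", OF pM _ inj \<iota> X H1[OF p] sH[OF p, of "p + 1"]]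
    show ?thesis
      unfolding rR_def z_def using e by auto
  qed
  have V: "has_bochner_integral (PiM {1..n} M) V (\<sigma>\<^sup>2 * (\<Sum>p\<le>k. 2 * (\<Sum>j<N p. \<integral>Y. (rL p j Y)\<^sup>2 \<partial>PiM {1..n} M)
       + 2 * (\<Sum>j<N p. \<integral>Y. (rR p j Y)\<^sup>2 \<partial>PiM {1..n} M) + 2 * (G p)\<^sup>2 / real (N p)))"
  proof -
    have const: "has_bochner_integral (PiM {1..n} M) (\<lambda>_. c) c" for c :: real
      unfolding has_bochner_integral_iff using P.integrable_const[of c] P.prob_space by simp
    have "has_bochner_integral (PiM {1..n} M) (\<lambda>Y. (rL p j Y)\<^sup>2) (\<integral>Y. (rL p j Y)\<^sup>2 \<partial>PiM {1..n} M)"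
      and "has_bochner_integral (PiM {1..n} M) (\<lambda>Y. (rR p j Y)\<^sup>2) (\<integral>Y. (rR p j Y)\<^sup>2 \<partial>PiM {1..n} M)"
      if "p \<in> {..k}" "j \<in> {..<N p}" for p j
      using L[of p] R[of p] that by (auto intro: has_bochner_integral_integrable)
    then show ?thesis unfolding V_def
      by (intro has_bochner_integral_mult_right has_bochner_integral_sum has_bochner_integral_add const)
  qed
  then have Vint: "integrable (PiM {1..n} M) V" by (rule integrable.intros)
  have "squared_error n (penalized_estimator n \<sigma> l) \<theta> \<in> borel_measurable (PiM {1..n} M)"
  proof -
    have "(\<lambda>Y. \<Sum>i=1..n. (penalized_estimator n \<sigma> l Y i - \<theta> i)\<^sup>2) \<in> borel_measurable (PiM {1..n} M)"
      using measurable_penalized_estimator[of \<sigma> l, OF _ _ setsM] \<sigma> l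
      by (intro borel_measurable_sum borel_measurable_power borel_measurable_diff borel_measurable_const) auto
    then show ?thesis unfolding squared_error_def[abs_def] norm2_power2 by simp
  qed
  moreover have "0 \<le> squared_error n (penalized_estimator n \<sigma> l) \<theta> Y" for Y unfolding squared_error_def by simp
  ultimately have int: "integrable (PiM {1..n} M) (squared_error n (penalized_estimator n \<sigma> l) \<theta>)"
    using dom by (intro Bochner_Integration.integrable_bound[OF Vint]) (auto intro!: AE_I2 order_trans[OF _ abs_ge_self])
  then show "integrable (gaussian n \<theta> \<sigma>) (squared_error n (penalized_estimator n \<sigma> l) \<theta>)" unfolding gM .
  have "(\<integral>Y. squared_error n (penalized_estimator n \<sigma> l) \<theta> Y \<partial>PiM {1..n} M) \<le> (\<integral>Y. V Y \<partial>PiM {1..n} M)"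
    using int Vint dom by (intro integral_mono) auto
  also have "\<dots> = \<sigma>\<^sup>2 * (\<Sum>p\<le>k. 2 * (\<Sum>j<N p. \<integral>Y. (rL p j Y)\<^sup>2 \<partial>PiM {1..n} M)
       + 2 * (\<Sum>j<N p. \<integral>Y. (rR p j Y)\<^sup>2 \<partial>PiM {1..n} M) + 2 * (G p)\<^sup>2 / real (N p))"
    using V by (rule has_bochner_integral_integral_eq)
  also have "\<dots> \<le> \<sigma>\<^sup>2 * (\<Sum>p\<le>k. 4 * (energy_const * ln (1 + H p) + 1800 * energy_const * real (N p) / (H p)\<^sup>2)
             + 2 * (G p)\<^sup>2 / real (N p))"
  proof (intro mult_left_mono sum_mono)
    fix p assume "p \<in> {..k}"
    then have p: "p \<le> k" by simp
    show "2 * (\<Sum>j<N p. \<integral>Y. (rL p j Y)\<^sup>2 \<partial>PiM {1..n} M)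
       + 2 * (\<Sum>j<N p. \<integral>Y. (rR p j Y)\<^sup>2 \<partial>PiM {1..n} M) + 2 * (G p)\<^sup>2 / real (N p)
       \<le> 4 * (energy_const * ln (1 + H p) + 1800 * energy_const * real (N p) / (H p)\<^sup>2) + 2 * (G p)\<^sup>2 / real (N p)"
    proof -
      have "2 * x + 2 * y + g \<le> 4 * e + g" if "x \<le> e" "y \<le> e" for x y e g :: real
        using that by simp
      then show ?thesis using L[OF p] R[OF p] by blast
    qed
  qed simp
  finally show "(\<integral>Y. squared_error n (penalized_estimator n \<sigma> l) \<theta> Y \<partial>gaussian n \<theta> \<sigma>)
      \<le> \<sigma>\<^sup>2 * (\<Sum>p\<le>k. 4 * (energy_const * ln (1 + H p) + 1800 * energy_const * real (N p) / (H p)\<^sup>2)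
             + 2 * (G p)\<^sup>2 / real (N p))" unfolding gM .
qed

section \<open>A lower bound for the constant of the tuning parameter\<close>

text \<open>The vector \<open>(0, 1)\<close> is balanced for all constants \<open>c1 \<le> 1 \<le> c2\<close>, and its subdifferential is the single
  point \<open>(-1, 1)\<close>. It serves to bound the constants of \<^const>\<open>is_Cstar\<close> from below.\<close>

lemma single_jump_facts:
  defines "\<theta> \<equiv> (\<lambda>i\<in>{1..2::nat}. if i = 1 then 0 else 1 :: real)"
  shows "num_jumps 2 \<theta> = 1" "piece_length 2 \<theta> 0 = 1" "piece_length 2 \<theta> 1 = 1" "sign_changes 2 \<theta> = {0, 1}"
proof -
  have j: "jumps 2 \<theta> = {2}" unfolding jumps_def \<theta>_def by auto
  show k: "num_jumps 2 \<theta> = 1" unfolding num_jumps_def j by simp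
  have ji: "jump_index 2 \<theta> 0 = 1" "jump_index 2 \<theta> (Suc 0) = 2" "jump_index 2 \<theta> (Suc (Suc 0)) = 3"
    unfolding jump_index_def k j by auto
  show "piece_length 2 \<theta> 0 = 1" "piece_length 2 \<theta> 1 = 1" unfolding piece_length_def by (simp_all add: ji)
  have th: "\<theta> (Suc 0) = 0" "\<theta> 2 = 1" unfolding \<theta>_def by auto
  have js: "jump_sign 2 \<theta> 0 = 0" "jump_sign 2 \<theta> (Suc 0) = 1" "jump_sign 2 \<theta> (Suc (Suc 0)) = 0"
    unfolding jump_sign_def k ji by (simp_all add: th)
  have "i \<in> sign_changes 2 \<theta> \<longleftrightarrow> i = 0 \<or> i = 1" for i
  proof -
    consider "i = 0" | "i = Suc 0" | "1 < i" by linarith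
    then show ?thesis unfolding sign_changes_def k by cases (simp_all add: js)
  qed
  then show "sign_changes 2 \<theta> = {0, 1}" by blast
qed

lemma subdifferential_single_jump:
  "subdifferential 2 (tv 2) (\<lambda>i\<in>{1..2::nat}. if i = 1 then 0 else 1 :: real)
     = {\<lambda>i\<in>{1..2::nat}. if i = 1 then -1 else 1}" (is "subdifferential 2 (tv 2) ?\<theta> = {?v}")
proof -
  have s2: "(\<Sum>i=1..2::nat. f i) = f 1 + f 2" for f :: "nat \<Rightarrow> real" by (simp add: numeral_2_eq_2)
  have tv2: "tv 2 y = \<bar>y 2 - y 1\<bar>" for y unfolding tv_eq by (simp add: numeral_2_eq_2)
  show ?thesis
  proof (intro equalityI subsetI)
    fix v assume "v \<in> subdifferential 2 (tv 2) ?\<theta>"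
    then have v: "v \<in> Rn 2" and ineq: "\<And>y. y \<in> Rn 2 \<Longrightarrow> 1 + (v 1 * y 1 + v 2 * (y 2 - 1)) \<le> \<bar>y 2 - y 1\<bar>"
      unfolding subdifferential_def tv2 inner_n_def s2 by auto
    have ineq': "1 + (v 1 * a + v 2 * (b - 1)) \<le> \<bar>b - a\<bar>" for a b
      using ineq[of "\<lambda>i\<in>{1..2}. if i = 1 then a else b"] unfolding Rn_def by auto
    have "v 2 = 1" "v 1 = -1"
      using ineq'[of 1 2] ineq'[of "-1" 0] ineq'[of 0 2] ineq'[of 0 0] by auto
    then show "v \<in> {?v}" using v unfolding Rn_def
      by (auto simp: fun_eq_iff PiE_def extensional_def restrict_def) (metis One_nat_def Suc_1 atLeastAtMost_iff le_SucE le_antisym)+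
  next
    fix v assume "v \<in> {?v}"
    then show "v \<in> subdifferential 2 (tv 2) ?\<theta>"
      unfolding subdifferential_def tv2 inner_n_def s2 Rn_def by auto
  qed
qed

text \<open>The bound on \<^const>\<open>lambda_star\<close> is a bound from above, so it forces \<open>Cs\<close> to be large: for the vector
  \<open>(0, 1)\<close> the square root is \<open>1\<close>, while \<^const>\<open>lambda_star\<close> is at least \<open>2 / norm2 2 (v0 2 \<theta>) = sqrt 2\<close>.\<close>

lemma is_Cstar_ge_1:
  assumes c: "c1 \<le> 1" "1 \<le> c2" and Cs: "is_Cstar c1 c2 Cs"
  shows "1 \<le> Cs"
proof -
  define \<theta> where "\<theta> = (\<lambda>i\<in>{1..2::nat}. if i = 1 then 0 else 1 :: real)"
  define v where "v = (\<lambda>i\<in>{1..2::nat}. if i = 1 then -1 else 1 :: real)"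
  note facts = single_jump_facts[folded \<theta>_def]
  have sub: "subdifferential 2 (tv 2) \<theta> = {v}"
    unfolding \<theta>_def v_def by (rule subdifferential_single_jump)
  have s2: "(\<Sum>i=1..2::nat. f i) = f 1 + f 2" for f :: "nat \<Rightarrow> real" by (simp add: numeral_2_eq_2)
  have n2: "norm2 2 x = sqrt ((x 1)\<^sup>2 + (x 2)\<^sup>2)" for x unfolding norm2_def L2_set_def s2 ..
  have "affine_hull_n 2 {v} = {v}"
  proof (intro equalityI subsetI)
    fix x assume "x \<in> affine_hull_n 2 {v}"
    then obtain F u where F: "F \<noteq> {}" "F \<subseteq> {v}" "sum u F = 1" "x = (\<lambda>i\<in>{1..2}. \<Sum>w\<in>F. u w * w i)"
      unfolding affine_hull_n_def by auto
    then have "F = {v}" by auto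
    then show "x \<in> {v}" using F by (auto simp: v_def fun_eq_iff)
  next
    fix x assume "x \<in> {v}"
    then show "x \<in> affine_hull_n 2 {v}" unfolding affine_hull_n_def
      by (auto intro!: exI[of _ "{v}"] exI[of _ "\<lambda>_. 1"] simp: v_def)
  qed
  moreover have "is_arg_min (norm2 2) (\<lambda>x. x \<in> {v}) = (\<lambda>x. x = v)"
    by (intro ext) (auto simp: is_arg_min_def)
  ultimately have "v0 2 \<theta> = v" unfolding v0_def sub
    by (simp add: arg_min_on_def arg_min_def)
  then have nv: "norm2 2 (v0 2 \<theta>) = sqrt 2" unfolding n2 by (simp add: v_def)
  have tun: "0 \<le> tuning 2 \<theta> z" for z
  proof -
    define f where "f = (\<lambda>l. INF w\<in>subdifferential 2 (tv 2) \<theta>. norm2 2 (z - (\<lambda>i. l * w i)))"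
    \<comment> \<open>completing the square shows where the minimum over the half-line is\<close>
    have f: "f l = sqrt (2 * (l - (z 2 - z 1) / 2)\<^sup>2 + (z 1 + z 2)\<^sup>2 / 2)" for l
      unfolding f_def sub n2 by (simp add: v_def) (simp add: power2_eq_square algebra_simps add_divide_distrib diff_divide_distrib)
    have "f (max 0 ((z 2 - z 1) / 2)) \<le> f l" if "0 \<le> l" for l
    proof -
      have "\<bar>max 0 ((z 2 - z 1) / 2) - (z 2 - z 1) / 2\<bar> \<le> \<bar>l - (z 2 - z 1) / 2\<bar>"
        using that by (auto simp: max_def)
      then have "(max 0 ((z 2 - z 1) / 2) - (z 2 - z 1) / 2)\<^sup>2 \<le> (l - (z 2 - z 1) / 2)\<^sup>2"
        by (rule abs_le_square_iff[THEN iffD1])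
      then show ?thesis unfolding f by simp
    qed
    then have "is_arg_min f (\<lambda>x. x \<in> {0..}) (max 0 ((z 2 - z 1) / 2))"
      unfolding is_arg_min_linorder by auto
    then have "is_arg_min f (\<lambda>x. x \<in> {0..}) (arg_min_on f {0..})"
      unfolding arg_min_on_def arg_min_def by (rule someI)
    then have "arg_min_on f {0..} \<in> {0..}" unfolding is_arg_min_def by blast
    then show ?thesis unfolding tuning_def f_def by simp
  qed
  have "1 \<le> 2 / sqrt 2" by (simp add: real_div_sqrt)
  also have "\<dots> \<le> lambda_star 2 \<theta>"
    unfolding lambda_star_def nv using tun by (simp add: integral_nonneg_AE)
  also have "\<dots> \<le> Cs * sqrt (real 2 / real (card (sign_changes 2 \<theta>)) * log_term 2 \<theta>)"
  proof -
    have "\<theta> \<in> Rn 2" unfolding \<theta>_def Rn_def by auto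
    moreover have "balanced c1 c2 2 \<theta>"
      unfolding balanced_def facts(4) using c facts(1,2,3) by simp
    ultimately show ?thesis using Cs facts(1) unfolding is_Cstar_def by auto
  qed
  also have "\<dots> = Cs" unfolding log_term_def facts by simp
  finally show ?thesis .
qed

section \<open>The risk bounds\<close>

text \<open>Concavity of the logarithm: the pieces have average length \<open>n / (k + 1)\<close>.\<close>

lemma sum_ln_piece_length:
  assumes n: "1 \<le> n"
  shows "(\<Sum>p\<le>num_jumps n \<theta>. 1 + ln (real (piece_length n \<theta> p))) \<le> (real (num_jumps n \<theta>) + 1) * log_term n \<theta>"
proof -
  let ?k = "num_jumps n \<theta>" and ?N = "piece_length n \<theta>"
  define a where "a = real n / (real ?k + 1)"
  have a: "0 < a" unfolding a_def using n by simp
  have "1 + ln (real (?N p)) \<le> ln a + real (?N p) / a" if "p \<le> ?k" for p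
  proof -
    have N: "0 < real (?N p)" using piece_length_pos[OF n that] by simp
    have "ln (real (?N p) / a) \<le> real (?N p) / a - 1" using N a by (intro ln_le_minus_one) auto
    then show ?thesis using N a by (simp add: ln_div)
  qed
  then have "(\<Sum>p\<le>?k. 1 + ln (real (?N p))) \<le> (\<Sum>p\<le>?k. ln a + real (?N p) / a)" by (intro sum_mono) auto
  also have "\<dots> = (real ?k + 1) * ln a + real (\<Sum>p\<le>?k. ?N p) / a"
    by (simp add: sum.distrib sum_divide_distrib algebra_simps)
  also have "\<dots> = (real ?k + 1) * ln a + (real ?k + 1)"
    unfolding sum_piece_length[OF n] using n by (simp add: a_def)
  also have "\<dots> = (real ?k + 1) * (1 + ln a)" by (simp add: algebra_simps)
  also have "1 + ln a = log_term n \<theta>"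
    unfolding log_term_def using a n ln_mult[of "exp 1" a] by (simp add: a_def)
  finally show ?thesis .
qed

lemma log_term_ge_1:
  assumes n: "1 \<le> n"
  shows "1 \<le> log_term n \<theta>"
proof -
  have "real (num_jumps n \<theta>) + 1 \<le> real n" using num_jumps_less[OF n, of \<theta>] by linarith
  then have "exp 1 \<le> exp 1 * real n / (real (num_jumps n \<theta>) + 1)"
    by (simp only: pos_le_divide_eq) (auto intro!: mult_left_mono simp: pos_le_divide_eq)
  then have "ln (exp 1) \<le> log_term n \<theta>" unfolding log_term_def by (intro ln_mono) auto
  then show ?thesis by simp
qed

lemma log_term_le:
  assumes n: "1 \<le> n"
  shows "log_term n \<theta> \<le> ln (exp 1 * real n)"
  unfolding log_term_def using n by (intro ln_mono) (auto simp: field_simps)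

lemma finite_sign_changes: "finite (sign_changes n \<theta>)"
  unfolding sign_changes_def by simp

lemma card_sign_changes:
  assumes k: "1 \<le> num_jumps n \<theta>"
  shows "1 \<le> card (sign_changes n \<theta>)" "card (sign_changes n \<theta>) \<le> num_jumps n \<theta> + 1"
proof -
  have "0 \<in> sign_changes n \<theta>" unfolding sign_changes_def jump_sign_def using k by auto
  then show "1 \<le> card (sign_changes n \<theta>)" using finite_sign_changes by (metis One_nat_def Suc_leI card_gt_0_iff empty_iff)
  have "card (sign_changes n \<theta>) \<le> card {0..num_jumps n \<theta>}" unfolding sign_changes_def by (intro card_mono) auto
  then show "card (sign_changes n \<theta>) \<le> num_jumps n \<theta> + 1" by simp
qed

definition risk_const :: real where
  "risk_const = 7204 * energy_const + 8"

text \<open>The trade-off in \<open>l\<close>. A penalty that is too small costs \<open>n / l\<^sup>2\<close>, because walks in a narrow tube are pushed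
  back often. A penalty that is too large costs \<open>l\<^sup>2 / N\<close> on each piece in \<open>sign_changes\<close>, because there the dual
  path has to travel a distance of order \<open>l\<close>. Such pieces have length at least \<open>c1 n / (k + 1)\<close>.\<close>

lemma risk_le_of_penalty:
  assumes n: "1 \<le> n" and \<sigma>: "0 < \<sigma>" and l: "1 \<le> l" and \<theta>: "\<theta> \<in> Rn n"
    and c: "0 < c1" and bal: "balanced c1 c2 n \<theta>"
  defines "k \<equiv> num_jumps n \<theta>" and "m \<equiv> card (sign_changes n \<theta>)"
  shows "integrable (gaussian n \<theta> \<sigma>) (squared_error n (penalized_estimator n \<sigma> l) \<theta>)"
    and "risk n \<sigma> (penalized_estimator n \<sigma> l) \<theta> \<le> \<sigma>\<^sup>2 / real n *
       (risk_const * ((real k + 1) * log_term n \<theta> + real n / l\<^sup>2) + 8 / c1 * (real m * l\<^sup>2 * (real k + 1) / real n))"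
proof -
  define N where "N = piece_length n \<theta>"
  define H where "H = (\<lambda>p. min l (sqrt (real (N p))))"
  define G where "G = (\<lambda>p. if p \<in> sign_changes n \<theta> then 2 * l else 2 * H p)"
  have E0: "0 \<le> energy_const" unfolding energy_const_def by simp
  show "integrable (gaussian n \<theta> \<sigma>) (squared_error n (penalized_estimator n \<sigma> l) \<theta>)"
    by (rule gaussian_expected_squared_error(1)[OF n \<sigma> l \<theta>])
  have piece: "4 * (energy_const * ln (1 + H p) + 1800 * energy_const * real (N p) / (H p)\<^sup>2) + 2 * (G p)\<^sup>2 / real (N p)
      \<le> risk_const * (1 + ln (real (N p)) + real (N p) / l\<^sup>2)
        + 8 / c1 * (if p \<in> sign_changes n \<theta> then l\<^sup>2 * (real k + 1) / real n else 0)"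
    if p: "p \<le> k" for p
  proof -
    have N1: "1 \<le> real (N p)" using piece_length_pos[OF n] p unfolding N_def k_def by force
    have H0: "1 \<le> H p" using N1 l unfolding H_def by simp
    have HN: "H p \<le> sqrt (real (N p))" "H p \<le> l" unfolding H_def by auto
    have H2N: "(H p)\<^sup>2 \<le> real (N p)" using power_mono[OF HN(1), of 2] H0 N1 by simp
    have ln1: "ln (1 + H p) \<le> 1 + ln (real (N p))"
    proof -
      have "H p \<le> (H p)\<^sup>2" using H0 self_le_power[of "H p" 2] by simp
      then have "1 + H p \<le> 2 * real (N p)" using H2N N1 by linarith
      also have "\<dots> \<le> exp 1 * real (N p)" using N1 exp_ge_add_one_self[of 1] by (intro mult_right_mono) auto
      finally have "ln (1 + H p) \<le> ln (exp 1 * real (N p))" using H0 by (intro ln_mono) auto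
      then show ?thesis using N1 by (simp add: ln_mult)
    qed
    have NH: "real (N p) / (H p)\<^sup>2 \<le> 1 + real (N p) / l\<^sup>2"
    proof (cases "l \<le> sqrt (real (N p))")
      case True
      then show ?thesis unfolding H_def by simp
    next
      case False
      then have "(H p)\<^sup>2 = real (N p)" unfolding H_def by simp
      then show ?thesis using N1 l by simp
    qed
    have Gp: "2 * (G p)\<^sup>2 / real (N p) \<le> 8 + 8 / c1 * (if p \<in> sign_changes n \<theta> then l\<^sup>2 * (real k + 1) / real n else 0)"
    proof (cases "p \<in> sign_changes n \<theta>")
      case True
      have "Min (piece_length n \<theta> ` sign_changes n \<theta>) \<le> N p"
        unfolding N_def using True finite_sign_changes by (intro Min_le) auto
      then have "real (Min (piece_length n \<theta> ` sign_changes n \<theta>)) \<le> real (N p)" by simp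
      moreover have "c1 * real n / (real k + 1) \<le> real (Min (piece_length n \<theta> ` sign_changes n \<theta>))"
        using bal unfolding balanced_def k_def by blast
      ultimately have "c1 * real n / (real k + 1) \<le> real (N p)" by linarith
      then have "l\<^sup>2 / real (N p) \<le> l\<^sup>2 / (c1 * real n / (real k + 1))"
        using c n N1 by (intro divide_left_mono) auto
      then have "2 * (G p)\<^sup>2 / real (N p) \<le> 8 / c1 * (l\<^sup>2 * (real k + 1) / real n)"
        unfolding G_def using True by (simp add: power_mult_distrib)
      then show ?thesis using True by simp
    next
      case False
      have "2 * (G p)\<^sup>2 / real (N p) = 8 * ((H p)\<^sup>2 / real (N p))" unfolding G_def using False by (simp add: power_mult_distrib)
      also have "\<dots> \<le> 8 * 1" using H2N N1 by (intro mult_left_mono) auto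
      finally show ?thesis using False by simp
    qed
    have ln0: "0 \<le> ln (real (N p))" using N1 by simp
    have arith: "4 * (energy_const * A + 1800 * energy_const * B) + g \<le> risk_const * (1 + a + b) + S"
      if "A \<le> 1 + a" "B \<le> 1 + b" "g \<le> 8 + S" "0 \<le> a" "0 \<le> b" for A B a b g S :: real
    proof -
      have "energy_const * A \<le> energy_const * (1 + a)" "energy_const * B \<le> energy_const * (1 + b)"
        using that E0 by (auto intro: mult_left_mono)
      moreover have "0 \<le> (7200 * energy_const + 8) * a" "0 \<le> (4 * energy_const + 8) * b"
        using that E0 by auto
      ultimately show ?thesis using that(3) unfolding risk_const_def by (simp add: algebra_simps)
    qed
    show ?thesis
      using arith[OF ln1 NH Gp] ln0 by simp
  qed
  have "(\<integral>Y. squared_error n (penalized_estimator n \<sigma> l) \<theta> Y \<partial>gaussian n \<theta> \<sigma>)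
     \<le> \<sigma>\<^sup>2 * (\<Sum>p\<le>k. 4 * (energy_const * ln (1 + H p) + 1800 * energy_const * real (N p) / (H p)\<^sup>2) + 2 * (G p)\<^sup>2 / real (N p))"
    unfolding k_def N_def G_def H_def by (rule gaussian_expected_squared_error(2)[OF n \<sigma> l \<theta>])
  also have "\<dots> \<le> \<sigma>\<^sup>2 * (\<Sum>p\<le>k. risk_const * (1 + ln (real (N p)) + real (N p) / l\<^sup>2)
        + 8 / c1 * (if p \<in> sign_changes n \<theta> then l\<^sup>2 * (real k + 1) / real n else 0))"
    using piece by (intro mult_left_mono sum_mono) auto
  also have "(\<Sum>p\<le>k. risk_const * (1 + ln (real (N p)) + real (N p) / l\<^sup>2)
        + 8 / c1 * (if p \<in> sign_changes n \<theta> then l\<^sup>2 * (real k + 1) / real n else 0))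
     = risk_const * ((\<Sum>p\<le>k. 1 + ln (real (N p))) + real (\<Sum>p\<le>k. N p) / l\<^sup>2)
        + 8 / c1 * (\<Sum>p\<le>k. if p \<in> sign_changes n \<theta> then l\<^sup>2 * (real k + 1) / real n else 0)"
    by (simp only: sum.distrib sum_distrib_left[symmetric] of_nat_sum sum_divide_distrib[symmetric])
  also have "(\<Sum>p\<le>k. if p \<in> sign_changes n \<theta> then l\<^sup>2 * (real k + 1) / real n else 0) = real m * l\<^sup>2 * (real k + 1) / real n"
  proof -
    have "sign_changes n \<theta> = {p \<in> {..k}. p \<in> sign_changes n \<theta>}" unfolding sign_changes_def k_def by auto
    then have "(\<Sum>p\<le>k. if p \<in> sign_changes n \<theta> then l\<^sup>2 * (real k + 1) / real n else 0)
       = (\<Sum>p\<in>sign_changes n \<theta>. l\<^sup>2 * (real k + 1) / real n)"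
      by (subst sum.inter_filter[symmetric]) auto
    then show ?thesis unfolding m_def by simp
  qed
  also have "real (\<Sum>p\<le>k. N p) = real n" unfolding N_def k_def sum_piece_length[OF n] ..
  also have "\<sigma>\<^sup>2 * (risk_const * ((\<Sum>p\<le>k. 1 + ln (real (N p))) + real n / l\<^sup>2) + 8 / c1 * (real m * l\<^sup>2 * (real k + 1) / real n))
    \<le> \<sigma>\<^sup>2 * (risk_const * ((real k + 1) * log_term n \<theta> + real n / l\<^sup>2) + 8 / c1 * (real m * l\<^sup>2 * (real k + 1) / real n))"
    using sum_ln_piece_length[OF n, of \<theta>] E0 c unfolding N_def k_def risk_const_def
    by (intro mult_left_mono add_mono) auto
  finally have "1 / real n * (\<integral>Y. squared_error n (penalized_estimator n \<sigma> l) \<theta> Y \<partial>gaussian n \<theta> \<sigma>)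
    \<le> 1 / real n * (\<sigma>\<^sup>2 * (risk_const * ((real k + 1) * log_term n \<theta> + real n / l\<^sup>2) + 8 / c1 * (real m * l\<^sup>2 * (real k + 1) / real n)))"
    by (intro mult_left_mono) auto
  then show "risk n \<sigma> (penalized_estimator n \<sigma> l) \<theta> \<le> \<sigma>\<^sup>2 / real n *
       (risk_const * ((real k + 1) * log_term n \<theta> + real n / l\<^sup>2) + 8 / c1 * (real m * l\<^sup>2 * (real k + 1) / real n))"
    unfolding risk_def by simp
qed

theorem corollary2p10:
  fixes c1 :: real
  assumes "0 < c1" and "c1 \<le> 1"
  shows "\<exists>C::real. \<forall>c2 Cs. 1 \<le> c2 \<and> is_Cstar c1 c2 Cs \<longrightarrow>
    (\<forall>n \<sigma> \<theta> \<Gamma>.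
       2 \<le> n \<and> 0 < \<sigma> \<and> \<theta> \<in> Rn n \<and> 1 \<le> num_jumps n \<theta> \<and> balanced c1 c2 n \<theta> \<and> Cs \<le> \<Gamma> \<longrightarrow>
       (\<forall>l. l = \<Gamma> * sqrt (real n / real (card (sign_changes n \<theta>)) * log_term n \<theta>) \<longrightarrow>
          integrable (gaussian n \<theta> \<sigma>) (squared_error n (penalized_estimator n \<sigma> l) \<theta>) \<and>
          risk n \<sigma> (penalized_estimator n \<sigma> l) \<theta>
            \<le> C * \<sigma>\<^sup>2 * (1 + \<Gamma>\<^sup>2) * ((real (num_jumps n \<theta>) + 1) / real n) * log_term n \<theta>) \<and>
       (\<forall>l. l = \<Gamma> * sqrt (real n * ln (exp 1 * real n)) \<longrightarrow>
          integrable (gaussian n \<theta> \<sigma>) (squared_error n (penalized_estimator n \<sigma> l) \<theta>) \<and>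
          risk n \<sigma> (penalized_estimator n \<sigma> l) \<theta>
            \<le> C * (\<sigma>\<^sup>2 * (real (num_jumps n \<theta>) + 1) * ln (exp 1 * real n) / real n)
                * (1 + \<Gamma>\<^sup>2 * real (card (sign_changes n \<theta>)))))"
proof -
  have A0: "0 \<le> risk_const" unfolding risk_const_def energy_const_def by simp
  define C where "C = 2 * risk_const + 8 / c1"
  have C: "2 * risk_const \<le> C" "8 / c1 \<le> C" unfolding C_def using A0 assms by auto
  show ?thesis
  proof (intro exI[of _ C] allI impI, goal_cases)
    case (1 c2 Cs n \<sigma> \<theta> \<Gamma>)
    define k where "k = real (num_jumps n \<theta>) + 1"
    define m where "m = real (card (sign_changes n \<theta>))"
    define L where "L = log_term n \<theta>"
    define L' where "L' = ln (exp 1 * real n)"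
    have n: "1 \<le> n" and \<sigma>: "0 < \<sigma>" and \<theta>: "\<theta> \<in> Rn n" and bal: "balanced c1 c2 n \<theta>" using 1 by auto
    \<comment> \<open>this makes both penalties at least 1 and keeps n / l^2 small\<close>
    have \<Gamma>: "1 \<le> \<Gamma>" using is_Cstar_ge_1[OF assms(2)] 1 by force
    have m: "1 \<le> m" "m \<le> k" and k: "1 \<le> k" "k \<le> real n"
      using card_sign_changes[of n \<theta>] 1 num_jumps_less[OF n, of \<theta>] unfolding m_def k_def by auto
    have L: "1 \<le> L" "L \<le> L'" unfolding L_def L'_def by (rule log_term_ge_1[OF n] log_term_le[OF n])+
    have n0: "1 \<le> real n" using n by simp
    have \<Gamma>2: "1 \<le> \<Gamma>\<^sup>2" using \<Gamma> by simp
    note bound = risk_le_of_penalty[OF n \<sigma> _ \<theta> assms(1) bal, folded k_def m_def L_def]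
    have comb: "\<sigma>\<^sup>2 / real n * (risk_const * (a + b) + 8 / c1 * d) \<le> C * (\<sigma>\<^sup>2 / real n * (e + f))"
      if "a \<le> e" "b \<le> e" "0 \<le> e" "d \<le> f" "0 \<le> f" for a b d e f
    proof -
      have "risk_const * (a + b) \<le> risk_const * (2 * e)" using that A0 by (intro mult_left_mono) auto
      also have "\<dots> \<le> C * e" using C(1) that(3) by (metis mult.assoc mult.commute mult_right_mono)
      finally have "risk_const * (a + b) \<le> C * e" .
      moreover have "8 / c1 * d \<le> C * f" using that C(2) assms by (meson divide_nonneg_nonneg less_imp_le mult_mono order_trans mult_left_mono mult_right_mono zero_le_numeral)
      ultimately have "risk_const * (a + b) + 8 / c1 * d \<le> C * (e + f)" by (simp add: distrib_left)
      then have "\<sigma>\<^sup>2 / real n * (risk_const * (a + b) + 8 / c1 * d) \<le> \<sigma>\<^sup>2 / real n * (C * (e + f))"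
        by (intro mult_left_mono) auto
      then show ?thesis by (simp add: mult.left_commute)
    qed
    have l1: "1 \<le> l" if "l = \<Gamma> * sqrt (real n / m * L)" for l
    proof -
      have "1 \<le> real n / m" using m k by simp
      then have "1 * 1 \<le> real n / m * L" using L by (intro mult_mono) auto
      then have "1 * 1 \<le> \<Gamma> * sqrt (real n / m * L)" using \<Gamma> by (intro mult_mono) auto
      then show ?thesis unfolding that by simp
    qed
    have l1': "1 \<le> l" if "l = \<Gamma> * sqrt (real n * L')" for l
    proof -
      have "1 * 1 \<le> real n * L'" using L n0 by (intro mult_mono) auto
      then have "1 * 1 \<le> \<Gamma> * sqrt (real n * L')" using \<Gamma> by (intro mult_mono) auto
      then show ?thesis unfolding that by simp
    qed
    show ?case
    proof (intro conjI allI impI, goal_cases)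
      case (1 l)
      then show ?case using bound(1) l1 unfolding m_def L_def by blast
    next
      case (2 l)
      then have l: "l = \<Gamma> * sqrt (real n / m * L)" unfolding m_def L_def by simp
      have l2: "l\<^sup>2 = \<Gamma>\<^sup>2 * (real n / m * L)" unfolding l using n0 m L by (simp add: power_mult_distrib)
      have b: "real n / l\<^sup>2 \<le> k * L"
      proof -
        have "real n / l\<^sup>2 = m / (\<Gamma>\<^sup>2 * L)" unfolding l2 using n0 m L \<Gamma> by (simp add: field_simps)
        also have "\<dots> \<le> m / 1" using m L \<Gamma>2 mult_mono[of 1 "\<Gamma>\<^sup>2" 1 L] by (intro divide_left_mono) auto
        also have "\<dots> \<le> k * L" using m k L mult_mono[of m k 1 L] by simp
        finally show ?thesis .
      qed
      have d: "m * l\<^sup>2 * k / real n = \<Gamma>\<^sup>2 * (k * L)" unfolding l2 using n0 m by simp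
      have "risk n \<sigma> (penalized_estimator n \<sigma> l) \<theta> \<le> C * (\<sigma>\<^sup>2 / real n * (k * L + \<Gamma>\<^sup>2 * (k * L)))"
        by (rule order_trans[OF bound(2)[OF l1[OF l]] comb]) (use b d k L in auto)
      also have "\<dots> = C * \<sigma>\<^sup>2 * (1 + \<Gamma>\<^sup>2) * (k / real n) * L" by (simp add: field_simps)
      finally show ?case unfolding k_def L_def .
    next
      case (3 l)
      then show ?case using bound(1) l1' unfolding L'_def by blast
    next
      case (4 l)
      then have l: "l = \<Gamma> * sqrt (real n * L')" unfolding L'_def by simp
      have L'1: "1 \<le> L'" using L by simp
      have l2: "l\<^sup>2 = \<Gamma>\<^sup>2 * (real n * L')" unfolding l using n0 L'1 by (simp add: power_mult_distrib)
      have b: "real n / l\<^sup>2 \<le> k * L'"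
      proof -
        have "real n / l\<^sup>2 = 1 / (\<Gamma>\<^sup>2 * L')" unfolding l2 using n0 L'1 \<Gamma> by (simp add: field_simps)
        also have "\<dots> \<le> 1 / 1" using L'1 \<Gamma>2 mult_mono[of 1 "\<Gamma>\<^sup>2" 1 L'] by (intro divide_left_mono) auto
        also have "\<dots> \<le> k * L'" using k L'1 mult_mono[of 1 k 1 L'] by simp
        finally show ?thesis .
      qed
      have d: "m * l\<^sup>2 * k / real n = \<Gamma>\<^sup>2 * m * (k * L')" unfolding l2 using n0 by simp
      have a: "k * L \<le> k * L'" using k L by (intro mult_left_mono) auto
      have "risk n \<sigma> (penalized_estimator n \<sigma> l) \<theta> \<le> C * (\<sigma>\<^sup>2 / real n * (k * L' + \<Gamma>\<^sup>2 * m * (k * L')))"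
        by (rule order_trans[OF bound(2)[OF l1'[OF l]] comb]) (use a b d k L'1 m in auto)
      also have "\<dots> = C * (\<sigma>\<^sup>2 * k * L' / real n) * (1 + \<Gamma>\<^sup>2 * m)" by (simp add: field_simps)
      finally show ?case unfolding k_def L'_def m_def .
    qed
  qed
qed

end
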